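(* Let $N$ be a connected 2-step nilpotent Lie group with left-invariant pseudo-Riemannian metric tensor $\langle\,,\rangle$ and Lie algebra decomposed as $\mathfrak n=\mathfrak U\oplus\mathfrak Z\oplus\mathfrak V\oplus\mathfrak E$. If $[\mathfrak n,\mathfrak n]\subseteq\mathfrak U$ and $\mathfrak E=\{0\}$, then $N$ is flat.
   Context: An inner product is a nondegenerate symmetric bilinear form. $\mathfrak n$ has center $\mathfrak z$, $[\mathfrak n,\mathfrak n]\subseteq\mathfrak z$, and $\langle\,,\rangle$ also denotes the inner product on $\mathfrak n$. Decomposition: $\mathfrak U=\mathfrak z\cap\mathfrak z^\perp$; $\mathfrak V$ is a chosen totally null subspace with $\dim\mathfrak V=\dim\mathfrak U$, dually paired with $\mathfrak U$ by $\langle\,,\rangle$; $\mathfrak Z=\mathfrak z\cap\mathfrak U^\perp\cap\mathfrak V^\perp$; $\mathfrak E$ is the orthogonal complement of $\mathfrak Z$ in $\mathfrak U^\perp\cap\mathfrak V^\perp$. Thus $\mathfrak z=\mathfrak U\oplus\mathfrak Z$ and $\mathfrak n=\mathfrak U\oplus\mathfrak Z\oplus\mathfrak V\oplus\mathfrak E$. Flat means that the curvature tensor of the Levi-Civita connection vanishes. *)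

theory Defs
  imports "HOL-Analysis.Analysis" "HOL-Algebra.Group" "HOL-Library.Function_Algebras"
begin

text \<open>
  Pointwise real vector space structure on functions (the additive structure comes from
  \<open>Function_Algebras\<close>).  It is used for tangent vectors, which are operators on
  functions, and for vector fields, which are functions into tangent vectors, so that
  \<open>subspace\<close>, \<open>span\<close> and \<open>dim\<close> apply to both.
\<close>

instantiation "fun" :: (type, scaleR) scaleR
begin
definition scaleR_fun_def: "c *\<^sub>R f = (\<lambda>x. c *\<^sub>R f x)"
instance ..
end

instance "fun" :: (type, real_vector) real_vector
  by standard (simp_all add: scaleR_fun_def plus_fun_def fun_eq_iff algebra_simps)


section \<open>Smooth maps between open subsets of Euclidean spaces\<close>

text \<open>To be used on open sets only.\<close>

primrec Ck_on :: "nat \<Rightarrow> 'a::euclidean_space set \<Rightarrow> ('a \<Rightarrow> 'b::real_normed_vector) \<Rightarrow> bool" where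
  "Ck_on 0 S f \<longleftrightarrow> continuous_on S f"
| "Ck_on (Suc k) S f \<longleftrightarrow>
     f differentiable_on S \<and> (\<forall>v. Ck_on k S (\<lambda>x. frechet_derivative f (at x) v))"

definition smooth_on :: "'a::euclidean_space set \<Rightarrow> ('a \<Rightarrow> 'b::real_normed_vector) \<Rightarrow> bool" where
  "smooth_on S f \<longleftrightarrow> (\<forall>k. Ck_on k S f)"


section \<open>Smooth manifolds\<close>

text \<open>
  A manifold is a whole topological type with a (not necessarily maximal) smooth atlas.
  A chart is a pair of its domain and its coordinate map.
\<close>

type_synonym ('g, 'e) chart = "'g set \<times> ('g \<Rightarrow> 'e)"

definition is_chart :: "('g::topological_space, 'e::euclidean_space) chart \<Rightarrow> bool" where
  "is_chart = (\<lambda>(U, \<phi>). open U \<and> open (\<phi> ` U) \<and> homeomorphism U (\<phi> ` U) \<phi> (inv_into U \<phi>))"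

definition smooth_atlas :: "('g::topological_space, 'e::euclidean_space) chart set \<Rightarrow> bool" where
  "smooth_atlas A \<longleftrightarrow>
     (\<forall>c\<in>A. is_chart c) \<and>
     (\<Union>(U, \<phi>)\<in>A. U) = UNIV \<and>
     (\<forall>(U, \<phi>)\<in>A. \<forall>(V, \<psi>)\<in>A. smooth_on (\<phi> ` (U \<inter> V)) (\<psi> \<circ> inv_into U \<phi>))"

definition smooth_map ::
  "('g::topological_space, 'e::euclidean_space) chart set \<Rightarrow>
   ('h::topological_space, 'f::euclidean_space) chart set \<Rightarrow> ('g \<Rightarrow> 'h) \<Rightarrow> bool" where
  "smooth_map A B F \<longleftrightarrow>
     continuous_on UNIV F \<and>
     (\<forall>(U, \<phi>)\<in>A. \<forall>(V, \<psi>)\<in>B. smooth_on (\<phi> ` (U \<inter> F -` V)) (\<psi> \<circ> F \<circ> inv_into U \<phi>))"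

definition prod_atlas ::
  "('g, 'e) chart set \<Rightarrow> ('h, 'f) chart set \<Rightarrow> ('g \<times> 'h, 'e \<times> 'f) chart set" where
  "prod_atlas A B = {(U \<times> V, map_prod \<phi> \<psi>) |U \<phi> V \<psi>. (U, \<phi>) \<in> A \<and> (V, \<psi>) \<in> B}"

definition smooth_fun_on ::
  "('g::topological_space, 'e::euclidean_space) chart set \<Rightarrow> 'g set \<Rightarrow> ('g \<Rightarrow> real) \<Rightarrow> bool" where
  "smooth_fun_on A W f \<longleftrightarrow> (\<forall>(U, \<phi>)\<in>A. smooth_on (\<phi> ` (U \<inter> W)) (f \<circ> inv_into U \<phi>))"

definition smooth_near ::
  "('g::topological_space, 'e::euclidean_space) chart set \<Rightarrow> 'g \<Rightarrow> ('g \<Rightarrow> real) \<Rightarrow> bool" where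
  "smooth_near A p f \<longleftrightarrow> (\<exists>W. open W \<and> p \<in> W \<and> smooth_fun_on A W f)"


section \<open>Tangent vectors and vector fields\<close>

text \<open>
  Tangent vectors at \<open>p\<close> are the directional derivatives
  \<open>f \<mapsto> \<Sum>i. w\<^sub>i (\<partial>f / \<partial>x\<^sub>i) (p)\<close> acting on the real functions that are
  smooth near \<open>p\<close>.  They are set to \<open>0\<close> on all other functions, so that equality of
  tangent vectors is equality of operators.
\<close>

type_synonym 'g tangent = "('g \<Rightarrow> real) \<Rightarrow> real"
type_synonym 'g field = "'g \<Rightarrow> 'g tangent"

definition tangent_space ::
  "('g::topological_space, 'e::euclidean_space) chart set \<Rightarrow> 'g \<Rightarrow> 'g tangent set" where
  "tangent_space A p =
     {v. \<exists>(U, \<phi>)\<in>A. p \<in> U \<and>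
        (\<exists>w. v = (\<lambda>f. if smooth_near A p f
                      then frechet_derivative (f \<circ> inv_into U \<phi>) (at (\<phi> p)) w else 0))}"

definition vector_fields ::
  "('g::topological_space, 'e::euclidean_space) chart set \<Rightarrow> 'g field set" where
  "vector_fields A =
     {X. (\<forall>p. X p \<in> tangent_space A p) \<and>
         (\<forall>W f. open W \<longrightarrow> smooth_fun_on A W f \<longrightarrow> smooth_fun_on A W (\<lambda>p. X p f))}"

definition lie_bracket ::
  "('g::topological_space, 'e::euclidean_space) chart set \<Rightarrow>
   'g field \<Rightarrow> 'g field \<Rightarrow> 'g field" where
  "lie_bracket A X Y =
     (\<lambda>p f. if smooth_near A p f then X p (\<lambda>q. Y q f) - Y p (\<lambda>q. X q f) else 0)"

text \<open>The differential of a diffeomorphism.\<close>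

definition push :: "('g \<Rightarrow> 'h) \<Rightarrow> 'g tangent \<Rightarrow> 'h tangent" where
  "push F v = (\<lambda>f. v (f \<circ> F))"


section \<open>Pseudo-Riemannian metrics, Levi-Civita connection, flatness\<close>

text \<open>
  No positivity is required.  The index is locally constant, hence constant on a connected
  manifold.  Values of \<open>g p\<close> outside the tangent space at \<open>p\<close> are irrelevant.
\<close>

definition pseudo_riemannian_metric ::
  "('g::topological_space, 'e::euclidean_space) chart set \<Rightarrow>
   ('g \<Rightarrow> 'g tangent \<Rightarrow> 'g tangent \<Rightarrow> real) \<Rightarrow> bool" where
  "pseudo_riemannian_metric A g \<longleftrightarrow>
     (\<forall>p. \<forall>u\<in>tangent_space A p. \<forall>v\<in>tangent_space A p. g p u v = g p v u) \<and>
     (\<forall>p. \<forall>u\<in>tangent_space A p. \<forall>v\<in>tangent_space A p. \<forall>w\<in>tangent_space A p. \<forall>a b.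
        g p (a *\<^sub>R u + b *\<^sub>R v) w = a * g p u w + b * g p v w) \<and>
     (\<forall>p. \<forall>u\<in>tangent_space A p. (\<forall>v\<in>tangent_space A p. g p u v = 0) \<longrightarrow> u = 0) \<and>
     (\<forall>X\<in>vector_fields A. \<forall>Y\<in>vector_fields A. smooth_fun_on A UNIV (\<lambda>p. g p (X p) (Y p)))"

definition affine_connection ::
  "('g::topological_space, 'e::euclidean_space) chart set \<Rightarrow>
   ('g field \<Rightarrow> 'g field \<Rightarrow> 'g field) \<Rightarrow> bool" where
  "affine_connection A D \<longleftrightarrow>
     (\<forall>X\<in>vector_fields A. \<forall>Y\<in>vector_fields A. D X Y \<in> vector_fields A) \<and>
     (\<forall>X\<in>vector_fields A. \<forall>Y\<in>vector_fields A. \<forall>Z\<in>vector_fields A.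
        D (X + Y) Z = D X Z + D Y Z \<and> D X (Y + Z) = D X Y + D X Z) \<and>
     (\<forall>X\<in>vector_fields A. \<forall>Y\<in>vector_fields A. \<forall>f. smooth_fun_on A UNIV f \<longrightarrow>
        D (\<lambda>p. f p *\<^sub>R X p) Y = (\<lambda>p. f p *\<^sub>R D X Y p) \<and>
        D X (\<lambda>p. f p *\<^sub>R Y p) = (\<lambda>p. X p f *\<^sub>R Y p + f p *\<^sub>R D X Y p))"

definition levi_civita_connection ::
  "('g::topological_space, 'e::euclidean_space) chart set \<Rightarrow>
   ('g \<Rightarrow> 'g tangent \<Rightarrow> 'g tangent \<Rightarrow> real) \<Rightarrow>
   ('g field \<Rightarrow> 'g field \<Rightarrow> 'g field) \<Rightarrow> bool" where
  "levi_civita_connection A g D \<longleftrightarrow>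
     affine_connection A D \<and>
     (\<forall>X\<in>vector_fields A. \<forall>Y\<in>vector_fields A. D X Y - D Y X = lie_bracket A X Y) \<and>
     (\<forall>X\<in>vector_fields A. \<forall>Y\<in>vector_fields A. \<forall>Z\<in>vector_fields A. \<forall>p.
        X p (\<lambda>q. g q (Y q) (Z q)) = g p (D X Y p) (Z p) + g p (Y p) (D X Z p))"

definition curvature ::
  "('g::topological_space, 'e::euclidean_space) chart set \<Rightarrow>
   ('g field \<Rightarrow> 'g field \<Rightarrow> 'g field) \<Rightarrow>
   'g field \<Rightarrow> 'g field \<Rightarrow> 'g field \<Rightarrow> 'g field" where
  "curvature A D X Y Z = D X (D Y Z) - D Y (D X Z) - D (lie_bracket A X Y) Z"

text \<open>
  On smooth vector fields the Levi-Civita connection is unique.  Asserting its existence makes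
  flatness a statement about that connection and not a vacuous one.
\<close>

definition flat ::
  "('g::topological_space, 'e::euclidean_space) chart set \<Rightarrow>
   ('g \<Rightarrow> 'g tangent \<Rightarrow> 'g tangent \<Rightarrow> real) \<Rightarrow> bool" where
  "flat A g \<longleftrightarrow>
     (\<exists>D. levi_civita_connection A g D) \<and>
     (\<forall>D. levi_civita_connection A g D \<longrightarrow>
        (\<forall>X\<in>vector_fields A. \<forall>Y\<in>vector_fields A. \<forall>Z\<in>vector_fields A. curvature A D X Y Z = 0))"


section \<open>Lie groups\<close>

definition lie_group ::
  "('g::topological_space, 'e::euclidean_space) chart set \<Rightarrow> 'g monoid \<Rightarrow> bool" where
  "lie_group A N \<longleftrightarrow>
     smooth_atlas A \<and> group N \<and> carrier N = UNIV \<and>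
     smooth_map (prod_atlas A A) A (\<lambda>(x, y). x \<otimes>\<^bsub>N\<^esub> y) \<and>
     smooth_map A A (\<lambda>x. inv\<^bsub>N\<^esub> x)"

definition lie_algebra ::
  "('g::topological_space, 'e::euclidean_space) chart set \<Rightarrow> 'g monoid \<Rightarrow> 'g field set" where
  "lie_algebra A N =
     {X \<in> vector_fields A. \<forall>a p. X (a \<otimes>\<^bsub>N\<^esub> p) = push (\<lambda>x. a \<otimes>\<^bsub>N\<^esub> x) (X p)}"

definition left_invariant_metric ::
  "('g::topological_space, 'e::euclidean_space) chart set \<Rightarrow> 'g monoid \<Rightarrow>
   ('g \<Rightarrow> 'g tangent \<Rightarrow> 'g tangent \<Rightarrow> real) \<Rightarrow> bool" where
  "left_invariant_metric A N g \<longleftrightarrow>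
     (\<forall>a p. \<forall>u\<in>tangent_space A p. \<forall>v\<in>tangent_space A p.
        g (a \<otimes>\<^bsub>N\<^esub> p) (push (\<lambda>x. a \<otimes>\<^bsub>N\<^esub> x) u) (push (\<lambda>x. a \<otimes>\<^bsub>N\<^esub> x) v) = g p u v)"

text \<open>The inner product induced on the Lie algebra.\<close>

definition lie_inner ::
  "'g monoid \<Rightarrow> ('g \<Rightarrow> 'g tangent \<Rightarrow> 'g tangent \<Rightarrow> real) \<Rightarrow> 'g field \<Rightarrow> 'g field \<Rightarrow> real" where
  "lie_inner N g X Y = g \<one>\<^bsub>N\<^esub> (X \<one>\<^bsub>N\<^esub>) (Y \<one>\<^bsub>N\<^esub>)"


section \<open>The decomposition of a 2-step nilpotent Lie algebra with inner product\<close>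

text \<open>
  Here \<open>n\<close> is the Lie algebra (a subspace of the ambient type), \<open>br\<close> its bracket and
  \<open>B\<close> its inner product.
\<close>

definition derived_algebra ::
  "'a::real_vector set \<Rightarrow> ('a \<Rightarrow> 'a \<Rightarrow> 'a) \<Rightarrow> 'a set" where
  "derived_algebra n br = span {br x y |x y. x \<in> n \<and> y \<in> n}"

definition lie_center :: "'a::real_vector set \<Rightarrow> ('a \<Rightarrow> 'a \<Rightarrow> 'a) \<Rightarrow> 'a set" where
  "lie_center n br = {x \<in> n. \<forall>y\<in>n. br x y = 0}"

definition two_step_nilpotent :: "'a::real_vector set \<Rightarrow> ('a \<Rightarrow> 'a \<Rightarrow> 'a) \<Rightarrow> bool" where
  "two_step_nilpotent n br \<longleftrightarrow> derived_algebra n br \<subseteq> lie_center n br"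

definition perp :: "'a set \<Rightarrow> ('a \<Rightarrow> 'a \<Rightarrow> real) \<Rightarrow> 'a set \<Rightarrow> 'a set" where
  "perp n B S = {x \<in> n. \<forall>s\<in>S. B x s = 0}"

definition part_U ::
  "'a::real_vector set \<Rightarrow> ('a \<Rightarrow> 'a \<Rightarrow> 'a) \<Rightarrow> ('a \<Rightarrow> 'a \<Rightarrow> real) \<Rightarrow> 'a set" where
  "part_U n br B = lie_center n br \<inter> perp n B (lie_center n br)"

definition admissible_V ::
  "'a::real_vector set \<Rightarrow> ('a \<Rightarrow> 'a \<Rightarrow> 'a) \<Rightarrow> ('a \<Rightarrow> 'a \<Rightarrow> real) \<Rightarrow> 'a set \<Rightarrow> bool" where
  "admissible_V n br B V \<longleftrightarrow>
     subspace V \<and> V \<subseteq> n \<and>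
     (\<forall>v\<in>V. \<forall>w\<in>V. B v w = 0) \<and>
     dim V = dim (part_U n br B) \<and>
     (\<forall>u\<in>part_U n br B. (\<forall>v\<in>V. B u v = 0) \<longrightarrow> u = 0) \<and>
     (\<forall>v\<in>V. (\<forall>u\<in>part_U n br B. B u v = 0) \<longrightarrow> v = 0)"

definition part_Z ::
  "'a::real_vector set \<Rightarrow> ('a \<Rightarrow> 'a \<Rightarrow> 'a) \<Rightarrow> ('a \<Rightarrow> 'a \<Rightarrow> real) \<Rightarrow> 'a set \<Rightarrow> 'a set" where
  "part_Z n br B V = lie_center n br \<inter> perp n B (part_U n br B) \<inter> perp n B V"

definition part_E ::
  "'a::real_vector set \<Rightarrow> ('a \<Rightarrow> 'a \<Rightarrow> 'a) \<Rightarrow> ('a \<Rightarrow> 'a \<Rightarrow> real) \<Rightarrow> 'a set \<Rightarrow> 'a set" where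
  "part_E n br B V = perp n B (part_U n br B) \<inter> perp n B V \<inter> perp n B (part_Z n br B V)"

end

(* Koszul's formula, computed on the finite frame of left-invariant fields, gives the Levi-Civita
connection D.  Let z be the center and U the intersection of z with its orthogonal complement.
For X, Y, Z in n the inner products are constant, so
2<D_X Y, Z> = <[X,Y],Z> - <[Y,Z],X> + <[Z,X],Y>.  If Z is central only <[X,Y],Z> remains, and it
is 0 because [n,n] lies in U; so D_X Y is orthogonal to z, and E = 0 forces it into U.  If Y = u
is in U, the right side is <[Z,X],u> = 0, so D_X u = 0.  Hence D_X D_Y = 0 on n, and for
w = [X,Y] in U also D_w Z = D_Z w + [w,Z] = 0.  So the curvature vanishes on the frame, and it is
tensorial. *)

theory Submission
  imports Defs
begin

section \<open>Calculus of smooth maps\<close>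

text \<open>The definitions speak of vector fields on the whole manifold, so a local argument would
  need cut-off functions. The group supplies a global frame instead: every field is a finite sum of
  globally smooth functions times left-invariant fields. Smoothness of brackets, the representation
  of functionals that yields the connection, and the vanishing of curvature are all reduced to
  left-invariant fields along this frame. As the metric may be indefinite, the frame is not
  orthonormalised but comes with a metric-dual family. The same algebra, applied to U and a basis of
  the null space V, produces the element of U that pairs with V as a given vector does. This is how
  E = 0 enters: subtracting that element from a vector orthogonal to z leaves a vector of E. The
  curvature is computed for an arbitrary Levi-Civita connection, since Koszul's formula determines
  its values.\<close>

lemma Ck_on_Suc_iff:
  assumes "open S"
  shows "Ck_on (Suc k) S f \<longleftrightarrow>
    (\<forall>x\<in>S. f differentiable (at x)) \<and> (\<forall>v. Ck_on k S (\<lambda>x. frechet_derivative f (at x) v))"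
  using assms by (simp add: differentiable_on_eq_differentiable_at)

text \<open>Openness carries the proof: \<open>frechet_derivative\<close> at a point of
  \<open>S\<close> depends on the values of the function near that point, and agreement is only
  given on \<open>S\<close>.\<close>

lemma Ck_on_cong:
  assumes "open S" "\<And>x. x \<in> S \<Longrightarrow> f x = g x" "Ck_on k S f"
  shows "Ck_on k S g"
  using assms(2,3)
proof (induction k arbitrary: f g)
  case 0
  then show ?case using continuous_on_cong[of S S f g] by simp
next
  case (Suc k)
  have d: "\<forall>x\<in>S. f differentiable at x" and c: "\<And>v. Ck_on k S (\<lambda>x. frechet_derivative f (at x) v)"
    using Suc.prems(2) assms(1) by (simp_all add: differentiable_on_eq_differentiable_at)
  have e: "frechet_derivative f (at x) = frechet_derivative g (at x)" if "x \<in> S" for x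
    using frechet_derivative_transform_within_open[of f x S g] d that assms(1) Suc.prems(1) by blast
  have "g differentiable at x" if x: "x \<in> S" for x
  proof -
    obtain f' where "(f has_derivative f') (at x)" using d x by (auto simp: differentiable_def)
    then have "(g has_derivative f') (at x)"
      by (rule has_derivative_transform_within_open[OF _ assms(1) x]) (simp add: Suc.prems(1))
    then show ?thesis by (auto simp: differentiable_def)
  qed
  moreover have "Ck_on k S (\<lambda>x. frechet_derivative g (at x) v)" for v
    by (rule Suc.IH[OF _ c]) (simp add: e)
  ultimately show ?case using assms(1) by (simp add: Ck_on_Suc_iff del: Ck_on.simps)
qed

lemma Ck_on_subset:
  assumes "open S" "open T" "T \<subseteq> S" "Ck_on k S f"
  shows "Ck_on k T f"
  using assms(4)
proof (induction k arbitrary: f)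
  case 0
  then show ?case using assms(3) continuous_on_subset by auto
next
  case (Suc k)
  then show ?case using assms(1-3) by (auto simp: differentiable_on_eq_differentiable_at)
qed

lemma Ck_on_SucD:
  assumes "open S" "Ck_on (Suc k) S f"
  shows "Ck_on k S f"
  using assms(2)
proof (induction k arbitrary: f)
  case 0
  then show ?case by (simp add: differentiable_imp_continuous_on)
next
  case (Suc k)
  then show ?case by simp
qed

text \<open>Lets smoothness on the group be checked near each point, in whichever target chart is
  convenient there.\<close>

lemma Ck_on_local:
  assumes "open S" "\<And>x. x \<in> S \<Longrightarrow> \<exists>T. open T \<and> x \<in> T \<and> Ck_on k T f"
  shows "Ck_on k S f"
  using assms(2)
proof (induction k arbitrary: f)
  case 0
  have "isCont f x" if "x \<in> S" for x
    using 0[OF that] by (auto simp: continuous_on_eq_continuous_at)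
  then show ?case by (simp add: continuous_at_imp_continuous_on)
next
  case (Suc k)
  have "f differentiable at x" if "x \<in> S" for x
    using Suc.prems[OF that] by (auto simp: differentiable_on_eq_differentiable_at)
  moreover have "Ck_on k S (\<lambda>x. frechet_derivative f (at x) v)" for v
  proof (rule Suc.IH)
    fix x assume "x \<in> S"
    then obtain T where "open T" "x \<in> T" "Ck_on (Suc k) T f" using Suc.prems by blast
    then show "\<exists>T. open T \<and> x \<in> T \<and> Ck_on k T (\<lambda>x. frechet_derivative f (at x) v)"
      by (intro exI[of _ T]) simp
  qed
  ultimately show ?case using assms(1) by (simp add: Ck_on_Suc_iff del: Ck_on.simps)
qed

lemma Ck_on_const: "Ck_on k S (\<lambda>x. c)"
  by (induction k arbitrary: c) (simp_all add: Ck_on_Suc_iff)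

lemma Ck_on_add:
  assumes "open S" "Ck_on k S f" "Ck_on k S g"
  shows "Ck_on k S (\<lambda>x. f x + g x)"
  using assms(2,3)
proof (induction k arbitrary: f g)
  case 0
  then show ?case by (simp add: continuous_on_add)
next
  case (Suc k)
  have df: "\<forall>x\<in>S. f differentiable at x" and dg: "\<forall>x\<in>S. g differentiable at x"
    using Suc.prems assms(1) by (simp_all add: differentiable_on_eq_differentiable_at)
  have e: "frechet_derivative f (at x) v + frechet_derivative g (at x) v
      = frechet_derivative (\<lambda>x. f x + g x) (at x) v" if "x \<in> S" for x v
  proof -
    have "((\<lambda>x. f x + g x) has_derivative
        (\<lambda>v. frechet_derivative f (at x) v + frechet_derivative g (at x) v)) (at x)"
      using that df dg by (intro has_derivative_add) (auto simp: frechet_derivative_works[symmetric])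
    from frechet_derivative_at[OF this] show ?thesis by metis
  qed
  have "Ck_on k S (\<lambda>x. frechet_derivative (\<lambda>x. f x + g x) (at x) v)" for v
    using Suc.prems
    by (intro Ck_on_cong[OF assms(1) e Suc.IH]) auto
  then show ?case using df dg assms(1) by (simp add: Ck_on_Suc_iff del: Ck_on.simps)
qed

lemma Ck_on_sum:
  assumes "open S" "\<And>i. i \<in> I \<Longrightarrow> Ck_on k S (f i)"
  shows "Ck_on k S (\<lambda>x. \<Sum>i\<in>I. f i x)"
  using assms(2)
  by (induction I rule: infinite_finite_induct) (auto intro: Ck_on_const Ck_on_add[OF assms(1)])

lemma Ck_on_scaleR:
  assumes "open S" "Ck_on k S f" "Ck_on k S g"
  shows "Ck_on k S (\<lambda>x. f x *\<^sub>R g x)"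
  using assms(2,3)
proof (induction k arbitrary: f g)
  case 0
  then show ?case by (simp add: continuous_on_scaleR)
next
  case (Suc k)
  have df: "\<forall>x\<in>S. f differentiable at x" and dg: "\<forall>x\<in>S. g differentiable at x"
    using Suc.prems assms(1) by (simp_all add: differentiable_on_eq_differentiable_at)
  have e: "f x *\<^sub>R frechet_derivative g (at x) v + frechet_derivative f (at x) v *\<^sub>R g x
      = frechet_derivative (\<lambda>x. f x *\<^sub>R g x) (at x) v" if "x \<in> S" for x v
  proof -
    have "((\<lambda>x. f x *\<^sub>R g x) has_derivative
        (\<lambda>v. f x *\<^sub>R frechet_derivative g (at x) v + frechet_derivative f (at x) v *\<^sub>R g x)) (at x)"
      using that df dg by (intro has_derivative_scaleR) (auto simp: frechet_derivative_works[symmetric])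
    from frechet_derivative_at[OF this] show ?thesis by metis
  qed
  \<comment> \<open>The product rule leaves one factor undifferentiated in each term;
    \<open>Ck_on_SucD\<close> lowers that factor to order \<open>k\<close>, where the induction
    hypothesis applies.\<close>
  have "Ck_on k S (\<lambda>x. frechet_derivative (\<lambda>x. f x *\<^sub>R g x) (at x) v)" for v
    using Suc.prems Ck_on_SucD[OF assms(1) Suc.prems(1)] Ck_on_SucD[OF assms(1) Suc.prems(2)]
    by (intro Ck_on_cong[OF assms(1) e Ck_on_add[OF assms(1) Suc.IH Suc.IH]]) simp_all
  then show ?case using df dg assms(1) by (simp add: Ck_on_Suc_iff del: Ck_on.simps)
qed

lemma Ck_on_bounded_linear:
  assumes "open S" "bounded_linear L" "Ck_on k S f"
  shows "Ck_on k S (\<lambda>x. L (f x))"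
  using assms(3)
proof (induction k arbitrary: f)
  case 0
  then show ?case using assms(2) by (simp add: linear_continuous_on_compose bounded_linear.continuous_on)
next
  case (Suc k)
  have df: "\<forall>x\<in>S. f differentiable at x"
    using Suc.prems assms(1) by (simp_all add: differentiable_on_eq_differentiable_at)
  have h: "((\<lambda>x. L (f x)) has_derivative (\<lambda>v. L (frechet_derivative f (at x) v))) (at x)"
    if "x \<in> S" for x
    using that df
    by (intro bounded_linear.has_derivative[OF assms(2)]) (auto simp: frechet_derivative_works[symmetric])
  have "Ck_on k S (\<lambda>x. frechet_derivative (\<lambda>x. L (f x)) (at x) v)" for v
    using Suc.prems
    by (intro Ck_on_cong[OF assms(1) _ Suc.IH[of "\<lambda>x. frechet_derivative f (at x) v"]])
       (auto simp: frechet_derivative_at[symmetric, OF h])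
  moreover have "\<forall>x\<in>S. (\<lambda>x. L (f x)) differentiable at x" using h differentiable_def by blast
  ultimately show ?case using assms(1) by (simp add: Ck_on_Suc_iff del: Ck_on.simps)
qed

lemma Ck_on_compose:
  fixes f :: "'a::euclidean_space \<Rightarrow> 'b::euclidean_space" and g :: "'b \<Rightarrow> 'c::real_normed_vector"
  assumes "open S" "open T" "f ` S \<subseteq> T" "Ck_on k S f" "Ck_on k T g"
  shows "Ck_on k S (\<lambda>x. g (f x))"
  using assms(4,5)
proof (induction k arbitrary: g)
  case 0
  then show ?case using assms(3) by (simp add: continuous_on_compose2)
next
  case (Suc k)
  have df: "\<forall>x\<in>S. f differentiable at x" and dg: "\<forall>x\<in>T. g differentiable at x"
    using Suc.prems assms(1,2) by (simp_all add: differentiable_on_eq_differentiable_at)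
  have h: "((\<lambda>x. g (f x)) has_derivative
      (\<lambda>v. frechet_derivative g (at (f x)) (frechet_derivative f (at x) v))) (at x)"
    if "x \<in> S" for x
    using that df dg assms(3) diff_chain_at[of f _ x g]
    by (auto simp: frechet_derivative_works[symmetric] o_def image_subset_iff)
  \<comment> \<open>\<open>Ck_on\<close> speaks of derivatives in fixed directions, but the chain
    rule differentiates \<open>g\<close> in a direction that moves with \<open>x\<close>. Expanding
    this direction in \<open>Basis\<close> turns its motion into scalar coefficients.\<close>
  have e: "(\<Sum>b\<in>Basis. (frechet_derivative f (at x) v \<bullet> b) *\<^sub>R frechet_derivative g (at (f x)) b)
      = frechet_derivative (\<lambda>x. g (f x)) (at x) v" if "x \<in> S" for x v
  proof -
    have l: "linear (frechet_derivative g (at (f x)))"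
      using that dg assms(3) by (auto intro: linear_frechet_derivative)
    have "frechet_derivative g (at (f x)) (frechet_derivative f (at x) v)
      = frechet_derivative g (at (f x)) (\<Sum>b\<in>Basis. (frechet_derivative f (at x) v \<bullet> b) *\<^sub>R b)"
      by (simp add: euclidean_representation)
    also have "\<dots> = (\<Sum>b\<in>Basis. (frechet_derivative f (at x) v \<bullet> b) *\<^sub>R frechet_derivative g (at (f x)) b)"
      by (simp add: linear_sum[OF l] linear_scale[OF l])
    finally show ?thesis by (simp add: frechet_derivative_at[symmetric, OF h[OF that]])
  qed
  have f: "Ck_on k S f" using Suc.prems(1) Ck_on_SucD[OF assms(1)] by blast
  have "Ck_on k S (\<lambda>x. frechet_derivative (\<lambda>x. g (f x)) (at x) v)" for v
  proof (rule Ck_on_cong[OF assms(1) e])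
    show "Ck_on k S (\<lambda>x. \<Sum>b\<in>Basis. (frechet_derivative f (at x) v \<bullet> b) *\<^sub>R frechet_derivative g (at (f x)) b)"
      using Suc.prems
      by (intro Ck_on_sum Ck_on_scaleR Ck_on_bounded_linear[OF _ bounded_linear_inner_left] Suc.IH f assms(1)) auto
  qed
  moreover have "\<forall>x\<in>S. (\<lambda>x. g (f x)) differentiable at x" using h differentiable_def by blast
  ultimately show ?case using assms(1) by (simp add: Ck_on_Suc_iff del: Ck_on.simps)
qed

lemma Ck_on_ident: "Ck_on k S (\<lambda>x. x)"
proof (cases k)
  case (Suc m)
  then show ?thesis by (simp add: Ck_on_const)
qed simp

lemma smooth_on_cong:
  "open S \<Longrightarrow> (\<And>x. x \<in> S \<Longrightarrow> f x = g x) \<Longrightarrow> smooth_on S f \<Longrightarrow> smooth_on S g"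
  unfolding smooth_on_def by (blast intro: Ck_on_cong[of S f g])

lemma smooth_on_subset:
  "smooth_on S f \<Longrightarrow> open S \<Longrightarrow> open T \<Longrightarrow> T \<subseteq> S \<Longrightarrow> smooth_on T f"
  unfolding smooth_on_def by (blast intro: Ck_on_subset[of S T _ f])

lemma smooth_on_local:
  "open S \<Longrightarrow> (\<And>x. x \<in> S \<Longrightarrow> \<exists>T. open T \<and> x \<in> T \<and> smooth_on T f) \<Longrightarrow> smooth_on S f"
  unfolding smooth_on_def by (rule allI, rule Ck_on_local) blast+

lemma smooth_on_const: "smooth_on S (\<lambda>x. c)"
  by (simp add: smooth_on_def Ck_on_const)

lemma smooth_on_add:
  "open S \<Longrightarrow> smooth_on S f \<Longrightarrow> smooth_on S g \<Longrightarrow> smooth_on S (\<lambda>x. f x + g x)"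
  by (simp add: smooth_on_def Ck_on_add)

lemma smooth_on_mult:
  fixes f g :: "'a::euclidean_space \<Rightarrow> real"
  shows "open S \<Longrightarrow> smooth_on S f \<Longrightarrow> smooth_on S g \<Longrightarrow> smooth_on S (\<lambda>x. f x * g x)"
  using Ck_on_scaleR[of S _ f g] by (simp add: smooth_on_def)

lemma smooth_on_compose:
  fixes f :: "'a::euclidean_space \<Rightarrow> 'b::euclidean_space" and g :: "'b \<Rightarrow> 'c::real_normed_vector"
  shows "open S \<Longrightarrow> open T \<Longrightarrow> f ` S \<subseteq> T \<Longrightarrow> smooth_on S f \<Longrightarrow> smooth_on T g \<Longrightarrow>
    smooth_on S (\<lambda>x. g (f x))"
  by (simp add: smooth_on_def Ck_on_compose)

lemma smooth_on_Pair_const_left: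
  fixes c :: "'a::euclidean_space"
  assumes "open S"
  shows "smooth_on S (\<lambda>x::'b::euclidean_space. (c, x))"
proof -
  have "Ck_on k S (\<lambda>x. (c, 0) + (0, x))" for k
    using Ck_on_add[OF assms Ck_on_const
        Ck_on_bounded_linear[OF assms bounded_linear_Pair[OF bounded_linear_zero bounded_linear_ident] Ck_on_ident]] .
  then show ?thesis by (simp add: smooth_on_def)
qed

lemma smooth_on_Pair_const_right:
  fixes c :: "'a::euclidean_space"
  assumes "open S"
  shows "smooth_on S (\<lambda>x::'b::euclidean_space. (x, c))"
proof -
  have "Ck_on k S (\<lambda>x. (0, c) + (x, 0))" for k
    using Ck_on_add[OF assms Ck_on_const
        Ck_on_bounded_linear[OF assms bounded_linear_Pair[OF bounded_linear_ident bounded_linear_zero] Ck_on_ident]] .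
  then show ?thesis by (simp add: smooth_on_def)
qed

lemma smooth_on_differentiable:
  "smooth_on S f \<Longrightarrow> open S \<Longrightarrow> x \<in> S \<Longrightarrow> f differentiable (at x)"
  unfolding smooth_on_def using Ck_on_Suc_iff[of S 0 f] by blast

lemma smooth_on_frechet_derivative:
  "smooth_on S f \<Longrightarrow> smooth_on S (\<lambda>x. frechet_derivative f (at x) v)"
  unfolding smooth_on_def using Ck_on.simps(2)[of _ S f] by blast

section \<open>Smooth functions, tangent vectors and vector fields\<close>

lemma smooth_atlas_chart:
  assumes "smooth_atlas A" "(U, \<phi>) \<in> A"
  shows "open U" "x \<in> U \<Longrightarrow> inv_into U \<phi> (\<phi> x) = x"
    "open W \<Longrightarrow> open (\<phi> ` (U \<inter> W))" "continuous_on (\<phi> ` U) (inv_into U \<phi>)" "open (\<phi> ` U)"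
proof -
  have c: "open U" "open (\<phi> ` U)" and h: "homeomorphism U (\<phi> ` U) \<phi> (inv_into U \<phi>)"
    using assms by (auto simp: smooth_atlas_def is_chart_def)
  show "open U" "open (\<phi> ` U)" by fact+
  show "x \<in> U \<Longrightarrow> inv_into U \<phi> (\<phi> x) = x" "continuous_on (\<phi> ` U) (inv_into U \<phi>)"
    using h by (auto simp: homeomorphism_def)
  have "openin (top_of_set (\<phi> ` U)) (\<phi> ` (U \<inter> W))" if "open W"
    using that by (intro homeomorphism_imp_open_map[OF h]) auto
  then show "open W \<Longrightarrow> open (\<phi> ` (U \<inter> W))" using c(2) openin_open_trans by blast
qed

lemma smooth_atlas_cover:
  assumes "smooth_atlas A" obtains U \<phi> where "(U, \<phi>) \<in> A" "p \<in> U"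
proof -
  have "p \<in> (\<Union>(U, \<phi>)\<in>A. U)" using assms by (simp add: smooth_atlas_def)
  then show ?thesis using that by auto
qed

lemma smooth_map_id: "smooth_atlas A \<Longrightarrow> smooth_map A A (\<lambda>x. x)"
  by (auto simp: smooth_atlas_def smooth_map_def o_def split: prod.splits)

lemma smooth_fun_onD:
  "smooth_fun_on A W f \<Longrightarrow> (U, \<phi>) \<in> A \<Longrightarrow> smooth_on (\<phi> ` (U \<inter> W)) (f \<circ> inv_into U \<phi>)"
  by (auto simp: smooth_fun_on_def)

lemma smooth_fun_on_subset:
  assumes "smooth_atlas A" "smooth_fun_on A W f" "open W" "open T" "T \<subseteq> W"
  shows "smooth_fun_on A T f"
  unfolding smooth_fun_on_def
proof safe
  fix U \<phi> assume c: "(U, \<phi>) \<in> A"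
  show "smooth_on (\<phi> ` (U \<inter> T)) (f \<circ> inv_into U \<phi>)"
    by (rule smooth_on_subset[OF smooth_fun_onD[OF assms(2) c]])
       (use assms(3-5) smooth_atlas_chart(3)[OF assms(1) c] in auto)
qed

lemma smooth_fun_on_const: "smooth_fun_on A W (\<lambda>x. c)"
  by (auto simp: smooth_fun_on_def o_def smooth_on_const)

lemma smooth_fun_on_add:
  assumes "smooth_atlas A" "open W" "smooth_fun_on A W f" "smooth_fun_on A W h"
  shows "smooth_fun_on A W (\<lambda>x. f x + h x)"
  using assms(3,4) smooth_atlas_chart(3)[OF assms(1) _ assms(2)]
  by (fastforce simp: smooth_fun_on_def o_def intro: smooth_on_add)

lemma smooth_fun_on_mult:
  assumes "smooth_atlas A" "open W" "smooth_fun_on A W f" "smooth_fun_on A W h"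
  shows "smooth_fun_on A W (\<lambda>x. f x * h x)"
  using assms(3,4) smooth_atlas_chart(3)[OF assms(1) _ assms(2)]
  by (fastforce simp: smooth_fun_on_def o_def intro: smooth_on_mult)

lemma smooth_fun_on_diff:
  assumes "smooth_atlas A" "open W" "smooth_fun_on A W f" "smooth_fun_on A W h"
  shows "smooth_fun_on A W (\<lambda>x. f x - h x)"
  using smooth_fun_on_add[OF assms(1-3) smooth_fun_on_mult[OF assms(1,2) smooth_fun_on_const assms(4)], of "-1"]
  by simp

lemma smooth_near_differentiable:
  assumes "smooth_atlas A" "(U, \<phi>) \<in> A" "p \<in> U" "smooth_near A p f"
  shows "(f \<circ> inv_into U \<phi>) differentiable (at (\<phi> p))"
proof -
  obtain W where W: "open W" "p \<in> W" "smooth_fun_on A W f" using assms(4) by (auto simp: smooth_near_def)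
  show ?thesis
    by (rule smooth_on_differentiable[OF smooth_fun_onD[OF W(3) assms(2)]])
       (use W assms smooth_atlas_chart(3) in auto)
qed

text \<open>The two functions may be smooth on different neighbourhoods; both restrict to the
  intersection. Stated for a generic result \<open>k\<close> so that sums and products are
  instances.\<close>

lemma smooth_near_binop:
  assumes "smooth_atlas A" "smooth_near A p f" "smooth_near A p h"
    and "\<And>W. open W \<Longrightarrow> smooth_fun_on A W f \<Longrightarrow> smooth_fun_on A W h \<Longrightarrow> smooth_fun_on A W k"
  shows "smooth_near A p k"
proof -
  obtain W1 W2 where W: "open W1" "p \<in> W1" "smooth_fun_on A W1 f" "open W2" "p \<in> W2" "smooth_fun_on A W2 h"
    using assms(2,3) by (auto simp: smooth_near_def)
  have "smooth_fun_on A (W1 \<inter> W2) k"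
    using W by (intro assms(4)) (auto intro: smooth_fun_on_subset[OF assms(1)])
  then show ?thesis using W unfolding smooth_near_def by blast
qed

lemmas smooth_near_add = smooth_near_binop[OF _ _ _ smooth_fun_on_add]
lemmas smooth_near_mult = smooth_near_binop[OF _ _ _ smooth_fun_on_mult]

lemma smooth_map_open_vimage: "smooth_map A B F \<Longrightarrow> open W \<Longrightarrow> open (F -` W)"
  by (simp add: smooth_map_def open_vimage)

lemma smooth_fun_on_pullback:
  assumes A: "smooth_atlas A" and B: "smooth_atlas B" and F: "smooth_map A B F"
    and W: "open W" and f: "smooth_fun_on B W f"
  shows "smooth_fun_on A (F -` W) (f \<circ> F)"
  unfolding smooth_fun_on_def
proof safe
  fix U \<phi> assume c: "(U, \<phi>) \<in> A"
  show "smooth_on (\<phi> ` (U \<inter> F -` W)) (f \<circ> F \<circ> inv_into U \<phi>)"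
  proof (rule smooth_on_local)
    show "open (\<phi> ` (U \<inter> F -` W))"
      by (intro smooth_atlas_chart(3)[OF A c] smooth_map_open_vimage[OF F W])
    fix y assume "y \<in> \<phi> ` (U \<inter> F -` W)"
    then obtain x where x: "y = \<phi> x" "x \<in> U" "F x \<in> W" by auto
    obtain V \<psi> where d: "(V, \<psi>) \<in> B" "F x \<in> V" using smooth_atlas_cover[OF B] .
    \<comment> \<open>Shrinking to the points that \<open>F\<close> sends into one target chart
      makes \<open>f \<circ> F\<close> a composite of maps between Euclidean spaces.\<close>
    let ?T = "\<phi> ` (U \<inter> F -` (V \<inter> W))"
    have T: "open ?T"
      by (intro smooth_atlas_chart(3)[OF A c] smooth_map_open_vimage[OF F] open_Int W smooth_atlas_chart(1)[OF B d(1)])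
    have "smooth_on (\<phi> ` (U \<inter> F -` V)) (\<psi> \<circ> F \<circ> inv_into U \<phi>)"
      using F c d unfolding smooth_map_def by fast
    then have s: "smooth_on ?T (\<psi> \<circ> F \<circ> inv_into U \<phi>)"
      by (rule smooth_on_subset)
         (auto intro!: T smooth_atlas_chart(3)[OF A c] smooth_map_open_vimage[OF F] smooth_atlas_chart(1)[OF B d(1)]
          open_Int W)
    have "smooth_on ?T (\<lambda>x. (f \<circ> inv_into V \<psi>) ((\<psi> \<circ> F \<circ> inv_into U \<phi>) x))"
      by (rule smooth_on_compose[OF T _ _ s smooth_fun_onD[OF f d(1)]])
         (auto intro!: smooth_atlas_chart(3)[OF B d(1)] W simp: smooth_atlas_chart(2)[OF A c])
    then have "smooth_on ?T (f \<circ> F \<circ> inv_into U \<phi>)"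
      by (rule smooth_on_cong[OF T, rotated])
         (auto simp: smooth_atlas_chart(2)[OF A c] smooth_atlas_chart(2)[OF B d(1)])
    then show "\<exists>T. open T \<and> y \<in> T \<and> smooth_on T (f \<circ> F \<circ> inv_into U \<phi>)"
      using T x d by (intro exI[of _ ?T]) auto
  qed
qed

lemma smooth_near_pullback:
  assumes "smooth_atlas A" "smooth_atlas B" "smooth_map A B F" "smooth_near B (F p) f"
  shows "smooth_near A p (f \<circ> F)"
proof -
  obtain W where W: "open W" "F p \<in> W" "smooth_fun_on B W f" using assms(4) by (auto simp: smooth_near_def)
  then show ?thesis
    using smooth_fun_on_pullback[OF assms(1-3) W(1,3)] smooth_map_open_vimage[OF assms(3) W(1)]
    unfolding smooth_near_def by (intro exI[of _ "F -` W"]) auto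
qed

lemma smooth_map_chain_rule:
  assumes A: "smooth_atlas A" and B: "smooth_atlas B" and F: "smooth_map A B F"
    and c: "(U, \<phi>) \<in> A" "p \<in> U" and d: "(V, \<psi>) \<in> B" "F p \<in> V" and f: "smooth_near B (F p) f"
  shows "frechet_derivative (f \<circ> F \<circ> inv_into U \<phi>) (at (\<phi> p)) w =
    frechet_derivative (f \<circ> inv_into V \<psi>) (at (\<psi> (F p)))
      (frechet_derivative (\<psi> \<circ> F \<circ> inv_into U \<phi>) (at (\<phi> p)) w)"
proof -
  let ?T = "\<phi> ` (U \<inter> F -` V)"
  let ?t = "\<psi> \<circ> F \<circ> inv_into U \<phi>" and ?f = "f \<circ> inv_into V \<psi>"
  have T: "open ?T"
    by (intro smooth_atlas_chart(3)[OF A c(1)] smooth_map_open_vimage[OF F] smooth_atlas_chart(1)[OF B d(1)])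
  have p: "\<phi> p \<in> ?T" using c d by auto
  have tp: "?t (\<phi> p) = \<psi> (F p)" using smooth_atlas_chart(2)[OF A c] by simp
  have "smooth_on ?T ?t" using F c d unfolding smooth_map_def by fast
  then have "(?t has_derivative frechet_derivative ?t (at (\<phi> p))) (at (\<phi> p))"
    using smooth_on_differentiable[OF _ T p] frechet_derivative_works by blast
  moreover have "(?f has_derivative frechet_derivative ?f (at (\<psi> (F p)))) (at (\<psi> (F p)))"
    using smooth_near_differentiable[OF B d f] frechet_derivative_works by blast
  ultimately have "(?f \<circ> ?t has_derivative
      frechet_derivative ?f (at (\<psi> (F p))) \<circ> frechet_derivative ?t (at (\<phi> p))) (at (\<phi> p))"
    using diff_chain_at tp by metis
  then have "(f \<circ> F \<circ> inv_into U \<phi> has_derivative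
      frechet_derivative ?f (at (\<psi> (F p))) \<circ> frechet_derivative ?t (at (\<phi> p))) (at (\<phi> p))"
    by (rule has_derivative_transform_within_open[OF _ T p])
       (auto simp: smooth_atlas_chart(2)[OF A c(1)] smooth_atlas_chart(2)[OF B d(1)])
  then show ?thesis by (simp add: frechet_derivative_at[symmetric])
qed

text \<open>The operator inside \<open>tangent_space\<close> with its chart fixed: the vector with
  coordinates \<open>w\<close>.\<close>

definition coord_tangent ::
  "('g::topological_space, 'e::euclidean_space) chart set \<Rightarrow> 'g set \<Rightarrow> ('g \<Rightarrow> 'e) \<Rightarrow> 'g \<Rightarrow> 'e \<Rightarrow> 'g tangent" where
  "coord_tangent A U \<phi> p w =
     (\<lambda>f. if smooth_near A p f then frechet_derivative (f \<circ> inv_into U \<phi>) (at (\<phi> p)) w else 0)"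

text \<open>By the chain rule, \<open>push\<close> acts on coordinates by the Jacobian of
  \<open>F\<close>. The smooth inverse \<open>G\<close> is there for the default value 0: a function
  must be smooth near \<open>F p\<close> exactly when its pullback is smooth near
  \<open>p\<close>.\<close>

lemma push_coord_tangent:
  assumes A: "smooth_atlas A" and B: "smooth_atlas B" and F: "smooth_map A B F" and G: "smooth_map B A G"
    and GF: "\<And>x. G (F x) = x" and FG: "\<And>y. F (G y) = y"
    and c: "(U, \<phi>) \<in> A" "p \<in> U" and d: "(V, \<psi>) \<in> B" "F p \<in> V"
  shows "push F (coord_tangent A U \<phi> p w) =
    coord_tangent B V \<psi> (F p) (frechet_derivative (\<psi> \<circ> F \<circ> inv_into U \<phi>) (at (\<phi> p)) w)"
proof
  fix f
  have "smooth_near A p (f \<circ> F) \<longleftrightarrow> smooth_near B (F p) f"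
  proof
    assume "smooth_near A p (f \<circ> F)"
    then have "smooth_near B (F p) (f \<circ> F \<circ> G)"
      by (intro smooth_near_pullback[OF B A G]) (simp add: GF)
    then show "smooth_near B (F p) f" by (simp add: o_def FG)
  qed (rule smooth_near_pullback[OF A B F])
  then show "push F (coord_tangent A U \<phi> p w) f =
    coord_tangent B V \<psi> (F p) (frechet_derivative (\<psi> \<circ> F \<circ> inv_into U \<phi>) (at (\<phi> p)) w) f"
    using smooth_map_chain_rule[OF A B F c d] by (simp add: push_def coord_tangent_def)
qed

text \<open>The definition lets each vector choose its own chart. A change of charts is
  \<open>push_coord_tangent\<close> for the identity map, so any single chart around
  \<open>p\<close> reaches them all.\<close>

lemma tangent_space_eq_range:
  assumes A: "smooth_atlas A" and c: "(U, \<phi>) \<in> A" "p \<in> U"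
  shows "tangent_space A p = range (coord_tangent A U \<phi> p)"
proof -
  have "coord_tangent A V \<psi> p w \<in> range (coord_tangent A U \<phi> p)" if "(V, \<psi>) \<in> A" "p \<in> V" for V \<psi> w
    using push_coord_tangent[OF A A smooth_map_id[OF A] smooth_map_id[OF A] refl refl that c, of w]
    by (simp add: push_def o_def)
  then show ?thesis
    using c unfolding tangent_space_def coord_tangent_def by fast
qed

lemma linear_coord_tangent:
  assumes A: "smooth_atlas A" and c: "(U, \<phi>) \<in> A" "p \<in> U"
  shows "linear (coord_tangent A U \<phi> p)"
proof -
  have "linear (frechet_derivative (f \<circ> inv_into U \<phi>) (at (\<phi> p)))" if "smooth_near A p f" for f
    using smooth_near_differentiable[OF A c that] by (rule linear_frechet_derivative)
  then show ?thesis
    by (intro linearI) (auto simp: coord_tangent_def fun_eq_iff plus_fun_def scaleR_fun_def linear_add linear_scale)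
qed

lemma subspace_tangent_space:
  assumes "smooth_atlas A" shows "subspace (tangent_space A p)"
proof -
  obtain U \<phi> where c: "(U, \<phi>) \<in> A" "p \<in> U" using smooth_atlas_cover[OF assms] .
  show ?thesis
    unfolding tangent_space_eq_range[OF assms c]
    by (rule linear_subspace_image[OF linear_coord_tangent[OF assms c] subspace_UNIV])
qed

lemma tangent_not_smooth: "v \<in> tangent_space A p \<Longrightarrow> \<not> smooth_near A p f \<Longrightarrow> v f = 0"
  by (auto simp: tangent_space_def)

lemma tangent_const:
  "v \<in> tangent_space A p \<Longrightarrow> v (\<lambda>x. c) = 0"
  by (auto simp: tangent_space_def o_def)

lemma tangent_add:
  assumes A: "smooth_atlas A" and v: "v \<in> tangent_space A p" and f: "smooth_near A p f" and h: "smooth_near A p h"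
  shows "v (\<lambda>x. f x + h x) = v f + v h"
proof -
  obtain U \<phi> where c: "(U, \<phi>) \<in> A" "p \<in> U" using smooth_atlas_cover[OF A] .
  then obtain w where w: "v = coord_tangent A U \<phi> p w" using v tangent_space_eq_range[OF A c] by auto
  have "((\<lambda>x. (f \<circ> inv_into U \<phi>) x + (h \<circ> inv_into U \<phi>) x) has_derivative
      (\<lambda>w. frechet_derivative (f \<circ> inv_into U \<phi>) (at (\<phi> p)) w + frechet_derivative (h \<circ> inv_into U \<phi>) (at (\<phi> p)) w)) (at (\<phi> p))"
    using smooth_near_differentiable[OF A c f] smooth_near_differentiable[OF A c h]
    by (intro has_derivative_add) (simp_all only: frechet_derivative_works)
  from frechet_derivative_at[OF this, symmetric] show ?thesis
    using f h smooth_near_add[OF A f h A] by (simp add: w coord_tangent_def o_def)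
qed

lemma tangent_mult:
  assumes A: "smooth_atlas A" and v: "v \<in> tangent_space A p" and f: "smooth_near A p f" and h: "smooth_near A p h"
  shows "v (\<lambda>x. f x * h x) = f p * v h + v f * h p"
proof -
  obtain U \<phi> where c: "(U, \<phi>) \<in> A" "p \<in> U" using smooth_atlas_cover[OF A] .
  then obtain w where w: "v = coord_tangent A U \<phi> p w" using v tangent_space_eq_range[OF A c] by auto
  have "((\<lambda>x. (f \<circ> inv_into U \<phi>) x * (h \<circ> inv_into U \<phi>) x) has_derivative
      (\<lambda>w. (f \<circ> inv_into U \<phi>) (\<phi> p) * frechet_derivative (h \<circ> inv_into U \<phi>) (at (\<phi> p)) w
        + frechet_derivative (f \<circ> inv_into U \<phi>) (at (\<phi> p)) w * (h \<circ> inv_into U \<phi>) (\<phi> p))) (at (\<phi> p))"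
    using smooth_near_differentiable[OF A c f] smooth_near_differentiable[OF A c h]
    by (intro has_derivative_mult) (simp_all only: frechet_derivative_works)
  from frechet_derivative_at[OF this, symmetric] show ?thesis
    using f h smooth_near_mult[OF A f h A] smooth_atlas_chart(2)[OF A c]
    by (simp add: w coord_tangent_def o_def)
qed

section \<open>Vector fields as a module over the smooth functions, and their bracket\<close>

locale smooth_manifold =
  fixes A :: "('g::topological_space, 'e::euclidean_space) chart set"
  assumes atlas: "smooth_atlas A"
begin

abbreviation "VF \<equiv> vector_fields A"
abbreviation "smooth_fun \<equiv> smooth_fun_on A UNIV"
abbreviation "bracket \<equiv> lie_bracket A"

abbreviation fscale :: "('g \<Rightarrow> real) \<Rightarrow> 'g field \<Rightarrow> 'g field" (infixr \<open>\<odot>\<close> 75) where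
  "f \<odot> X \<equiv> (\<lambda>p. f p *\<^sub>R X p)"

lemma smooth_fun_near: "smooth_fun f \<Longrightarrow> smooth_near A p f"
  unfolding smooth_near_def by (intro exI[of _ UNIV]) auto

lemma VF_tangent: "X \<in> VF \<Longrightarrow> X p \<in> tangent_space A p"
  by (simp add: vector_fields_def)

lemma VF_smooth: "X \<in> VF \<Longrightarrow> open W \<Longrightarrow> smooth_fun_on A W f \<Longrightarrow> smooth_fun_on A W (\<lambda>p. X p f)"
  by (simp add: vector_fields_def)

lemma VF_smooth_near:
  assumes "X \<in> VF" "smooth_near A p f" shows "smooth_near A p (\<lambda>q. X q f)"
  using assms VF_smooth unfolding smooth_near_def by blast

lemma VF_zero: "0 \<in> VF"
  by (auto simp: vector_fields_def subspace_0[OF subspace_tangent_space[OF atlas]] smooth_fun_on_const)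

lemma VF_add: "X \<in> VF \<Longrightarrow> Y \<in> VF \<Longrightarrow> X + Y \<in> VF"
  by (auto simp: vector_fields_def subspace_add[OF subspace_tangent_space[OF atlas]] smooth_fun_on_add[OF atlas])

lemma VF_fscale: "smooth_fun f \<Longrightarrow> X \<in> VF \<Longrightarrow> f \<odot> X \<in> VF"
  unfolding vector_fields_def mem_Collect_eq
proof (intro conjI allI impI)
  assume a: "smooth_fun f" "(\<forall>p. X p \<in> tangent_space A p) \<and>
    (\<forall>W f. open W \<longrightarrow> smooth_fun_on A W f \<longrightarrow> smooth_fun_on A W (\<lambda>p. X p f))"
  show "f p *\<^sub>R X p \<in> tangent_space A p" for p
    using a subspace_scale[OF subspace_tangent_space[OF atlas]] by blast
  fix W h assume "open W" "smooth_fun_on A W h"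
  then show "smooth_fun_on A W (\<lambda>p. (f p *\<^sub>R X p) h)"
    using a smooth_fun_on_subset[OF atlas a(1), of W] by (simp add: scaleR_fun_def smooth_fun_on_mult[OF atlas])
qed

text \<open>Reduces real-linearity to linearity over smooth functions, a number being a constant
  function.\<close>

lemma scaleR_eq_fscale: "c *\<^sub>R X = (\<lambda>p. c) \<odot> X"
  by (simp add: scaleR_fun_def)

lemma VF_scaleR: "X \<in> VF \<Longrightarrow> c *\<^sub>R X \<in> VF"
  unfolding scaleR_eq_fscale by (intro VF_fscale smooth_fun_on_const)

lemma subspace_VF: "subspace VF"
  by (simp add: subspace_def VF_zero VF_add VF_scaleR)

lemmas VF_diff = subspace_diff[OF subspace_VF]
lemmas VF_uminus = subspace_neg[OF subspace_VF]
lemmas VF_sum = subspace_sum[OF subspace_VF]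

lemma bracket_skew: "bracket X Y = - bracket Y X"
  by (auto simp: lie_bracket_def fun_eq_iff)

lemma bracket_add:
  assumes "X \<in> VF" "Y \<in> VF" "Z \<in> VF"
  shows "bracket (X + Y) Z = bracket X Z + bracket Y Z"
proof (intro ext)
  fix p f
  show "bracket (X + Y) Z p f = (bracket X Z + bracket Y Z) p f"
  proof (cases "smooth_near A p f")
    case True
    then show ?thesis
      using tangent_add[OF atlas VF_tangent[OF assms(3)] VF_smooth_near[OF assms(1)] VF_smooth_near[OF assms(2)]]
      by (simp add: lie_bracket_def)
  qed (simp add: lie_bracket_def)
qed

text \<open>The correction term comes from the product rule when \<open>Z\<close> differentiates the
  product of \<open>f\<close> with the derivative along \<open>X\<close>.\<close>

lemma bracket_fscale:
  assumes "X \<in> VF" "Z \<in> VF" "smooth_fun f"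
  shows "bracket (f \<odot> X) Z = f \<odot> bracket X Z - (\<lambda>p. Z p f) \<odot> X"
proof (intro ext)
  fix p h
  show "bracket (f \<odot> X) Z p h = (f \<odot> bracket X Z - (\<lambda>p. Z p f) \<odot> X) p h"
  proof (cases "smooth_near A p h")
    case True
    then show ?thesis
      using tangent_mult[OF atlas VF_tangent[OF assms(2)] smooth_fun_near[OF assms(3)] VF_smooth_near[OF assms(1) True]]
      by (simp add: lie_bracket_def scaleR_fun_def algebra_simps)
  next
    \<comment> \<open>Off the functions smooth near \<open>p\<close>, brackets and tangent vectors
      all take the default value 0.\<close>
    case False
    then show ?thesis using tangent_not_smooth[OF VF_tangent[OF assms(1)]]
      by (simp add: lie_bracket_def scaleR_fun_def)
  qed
qed

lemma bracket_add_right: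
  assumes "X \<in> VF" "Y \<in> VF" "Z \<in> VF"
  shows "bracket X (Y + Z) = bracket X Y + bracket X Z"
  using bracket_add[OF assms(2,3,1)] bracket_skew[of X] by simp

lemma bracket_fscale_right:
  assumes "X \<in> VF" "Y \<in> VF" "smooth_fun f"
  shows "bracket X (f \<odot> Y) = f \<odot> bracket X Y + (\<lambda>p. X p f) \<odot> Y"
  unfolding bracket_skew[of X] bracket_fscale[OF assms(2,1,3)] by (simp add: fun_eq_iff scaleR_fun_def)

end

section \<open>Left-invariant fields\<close>

lemma push_push: "push F (push G v) = push (\<lambda>x. F (G x)) v"
  by (simp add: push_def o_def)

lemma push_ident: "push (\<lambda>x. x) v = v"
  by (simp add: push_def o_def)

locale lie_grp = smooth_manifold A
  for A :: "('g::topological_space, 'e::euclidean_space) chart set" +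
  fixes N :: "'g monoid" (structure)
  assumes lie_group: "lie_group A N"
begin

abbreviation "\<nn> \<equiv> lie_algebra A N"

lemma group: "group N" and carrier: "carrier N = UNIV"
  and smooth_map_mult: "smooth_map (prod_atlas A A) A (\<lambda>(x, y). x \<otimes> y)"
  using lie_group by (auto simp: lie_group_def)

lemma mult_assoc: "(a \<otimes> b) \<otimes> c = a \<otimes> (b \<otimes> c)"
  and mult_one: "\<one> \<otimes> a = a" "a \<otimes> \<one> = a"
  and mult_inv: "inv a \<otimes> a = \<one>" "a \<otimes> inv a = \<one>"
  and mult_inv_cancel: "inv a \<otimes> (a \<otimes> b) = b" "a \<otimes> (inv a \<otimes> b) = b"
proof -
  interpret group N by (rule group)
  show "(a \<otimes> b) \<otimes> c = a \<otimes> (b \<otimes> c)" "\<one> \<otimes> a = a" "a \<otimes> \<one> = a" "inv a \<otimes> a = \<one>" "a \<otimes> inv a = \<one>"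
    using carrier by (simp_all add: m_assoc)
  show "inv a \<otimes> (a \<otimes> b) = b" "a \<otimes> (inv a \<otimes> b) = b"
    using carrier by (simp_all add: m_assoc[symmetric])
qed

lemma continuous_mult: "continuous_on UNIV (\<lambda>z. fst z \<otimes> snd z)"
  using smooth_map_mult by (simp add: smooth_map_def case_prod_unfold)

section \<open>Group multiplication read in a pair of charts\<close>

context
  fixes U V :: "'g set" and \<phi> \<psi> :: "'g \<Rightarrow> 'e"
  assumes charts: "(U, \<phi>) \<in> A" "(V, \<psi>) \<in> A"
begin

text \<open>Only the two arguments are charted, not the product. The same map can then be followed
  by a chart of the target or by a real function on the group.\<close>

definition mult_coord :: "'e \<times> 'e \<Rightarrow> 'g" where
  "mult_coord z = inv_into U \<phi> (fst z) \<otimes> inv_into V \<psi> (snd z)"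

definition mult_dom :: "'g set \<Rightarrow> ('e \<times> 'e) set" where
  "mult_dom W = (\<phi> ` U \<times> \<psi> ` V) \<inter> mult_coord -` W"

lemma open_mult_dom:
  assumes "open W" shows "open (mult_dom W)"
proof -
  have "continuous_on (\<phi> ` U \<times> \<psi> ` V) (\<lambda>z. (inv_into U \<phi> (fst z), inv_into V \<psi> (snd z)))"
    using smooth_atlas_chart(4)[OF atlas charts(1)] smooth_atlas_chart(4)[OF atlas charts(2)]
    by (intro continuous_on_Pair continuous_on_compose2[OF _ continuous_on_fst[OF continuous_on_id]]
          continuous_on_compose2[OF _ continuous_on_snd[OF continuous_on_id]]) auto
  then have "continuous_on (\<phi> ` U \<times> \<psi> ` V) mult_coord"
    using continuous_on_compose2[OF continuous_mult] by (fastforce simp: mult_coord_def)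
  then show ?thesis
    unfolding mult_dom_def using assms smooth_atlas_chart(5)[OF atlas charts(1)] smooth_atlas_chart(5)[OF atlas charts(2)]
    by (intro continuous_open_preimage open_Times)
qed

lemma mult_dom_subset: "W \<subseteq> W' \<Longrightarrow> mult_dom W \<subseteq> mult_dom W'"
  by (auto simp: mult_dom_def)

lemma smooth_on_mult_coord:
  assumes "(V', \<theta>) \<in> A"
  shows "smooth_on (mult_dom V') (\<lambda>z. \<theta> (mult_coord z))"
proof -
  have inv: "inv_into (U \<times> V) (map_prod \<phi> \<psi>) (\<phi> a, \<psi> b) = (a, b)" if "a \<in> U" "b \<in> V" for a b
  proof -
    have "inj_on (map_prod \<phi> \<psi>) (U \<times> V)"
      using smooth_atlas_chart(2)[OF atlas charts(1)] smooth_atlas_chart(2)[OF atlas charts(2)]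
      by (intro map_prod_inj_on) (auto intro: inj_on_inverseI)
    from inv_into_f_f[OF this, of "(a, b)"] that show ?thesis by simp
  qed
  have "(U \<times> V, map_prod \<phi> \<psi>) \<in> prod_atlas A A" using charts unfolding prod_atlas_def by blast
  then have "smooth_on (map_prod \<phi> \<psi> ` ((U \<times> V) \<inter> (\<lambda>(x, y). x \<otimes> y) -` V'))
      (\<theta> \<circ> (\<lambda>(x, y). x \<otimes> y) \<circ> inv_into (U \<times> V) (map_prod \<phi> \<psi>))"
    using smooth_map_mult assms unfolding smooth_map_def by fast
  moreover have "map_prod \<phi> \<psi> ` ((U \<times> V) \<inter> (\<lambda>(x, y). x \<otimes> y) -` V') = mult_dom V'"
    by (auto simp: mult_dom_def mult_coord_def smooth_atlas_chart(2)[OF atlas charts(1)]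
          smooth_atlas_chart(2)[OF atlas charts(2)] intro!: image_eqI[where f = "map_prod \<phi> \<psi>"])
  ultimately have "smooth_on (mult_dom V') (\<theta> \<circ> (\<lambda>(x, y). x \<otimes> y) \<circ> inv_into (U \<times> V) (map_prod \<phi> \<psi>))"
    by simp
  then show ?thesis
    using smooth_atlas_chart(2)[OF atlas charts(1)] smooth_atlas_chart(2)[OF atlas charts(2)]
    by (rule_tac smooth_on_cong[OF open_mult_dom[OF smooth_atlas_chart(1)[OF atlas assms]]])
       (auto simp: mult_dom_def mult_coord_def inv)
qed

lemma smooth_on_fun_mult_coord:
  assumes W: "open W" and f: "smooth_fun_on A W f"
  shows "smooth_on (mult_dom W) (\<lambda>z. f (mult_coord z))"
proof (rule smooth_on_local[OF open_mult_dom[OF W]])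
  fix z assume z: "z \<in> mult_dom W"
  obtain V' \<theta> where d: "(V', \<theta>) \<in> A" "mult_coord z \<in> V'" using smooth_atlas_cover[OF atlas] .
  note V' = smooth_atlas_chart(1)[OF atlas d(1)]
  have T: "open (mult_dom (V' \<inter> W))" using V' W by (intro open_mult_dom open_Int)
  have s: "smooth_on (mult_dom (V' \<inter> W)) (\<lambda>z. \<theta> (mult_coord z))"
    by (rule smooth_on_subset[OF smooth_on_mult_coord[OF d(1)] open_mult_dom[OF V'] T]) (simp add: mult_dom_subset)
  have "smooth_on (mult_dom (V' \<inter> W)) (\<lambda>z. (f \<circ> inv_into V' \<theta>) (\<theta> (mult_coord z)))"
    by (rule smooth_on_compose[OF T smooth_atlas_chart(3)[OF atlas d(1) W] _ s smooth_fun_onD[OF f d(1)]])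
       (auto simp: mult_dom_def)
  then have "smooth_on (mult_dom (V' \<inter> W)) (\<lambda>z. f (mult_coord z))"
    by (rule smooth_on_cong[OF T, rotated]) (auto simp: mult_dom_def smooth_atlas_chart(2)[OF atlas d(1)])
  then show "\<exists>T. open T \<and> z \<in> T \<and> smooth_on T (\<lambda>z. f (mult_coord z))"
    using T z d by (intro exI[of _ "mult_dom (V' \<inter> W)"]) (auto simp: mult_dom_def)
qed

end

text \<open>In charts, translation by \<open>a\<close> is the slice of multiplication at first
  coordinate \<open>\<phi> a\<close>, and slices of smooth maps are smooth.\<close>

lemma smooth_map_translation: "smooth_map A A (\<lambda>x. a \<otimes> x)"
  unfolding smooth_map_def
proof safe
  have c: "continuous_on UNIV (\<lambda>x::'g. (a, x))" by (intro continuous_intros)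
  show cont: "continuous_on UNIV (\<lambda>x. a \<otimes> x)"
    using continuous_on_compose2[OF continuous_mult c] by simp
  fix V \<psi> V' \<theta> assume d: "(V, \<psi>) \<in> A" "(V', \<theta>) \<in> A"
  obtain U \<phi> where c: "(U, \<phi>) \<in> A" "a \<in> U" using smooth_atlas_cover[OF atlas] .
  note inv = smooth_atlas_chart(2)[OF atlas c] smooth_atlas_chart(2)[OF atlas d(1)]
  note V' = smooth_atlas_chart(1)[OF atlas d(2)]
  have S: "open (\<psi> ` (V \<inter> (\<lambda>x. a \<otimes> x) -` V'))"
    using open_vimage[OF V' cont] by (rule smooth_atlas_chart(3)[OF atlas d(1)])
  have "smooth_on (\<psi> ` (V \<inter> (\<lambda>x. a \<otimes> x) -` V')) (\<lambda>x. \<theta> (mult_coord U V \<phi> \<psi> (\<phi> a, x)))"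
    by (rule smooth_on_compose[OF S open_mult_dom[OF c(1) d(1) V'] _ smooth_on_Pair_const_left[OF S]
          smooth_on_mult_coord[OF c(1) d]])
       (auto simp: mult_dom_def[OF c(1) d(1)] mult_coord_def[OF c(1) d(1)] inv c)
  then show "smooth_on (\<psi> ` (V \<inter> (\<lambda>x. a \<otimes> x) -` V')) (\<theta> \<circ> (\<lambda>x. a \<otimes> x) \<circ> inv_into V \<psi>)"
    by (rule smooth_on_cong[OF S, rotated]) (auto simp: mult_coord_def[OF c(1) d(1)] inv)
qed

lemma push_translation_tangent:
  assumes "v \<in> tangent_space A p" shows "push (\<lambda>x. a \<otimes> x) v \<in> tangent_space A (a \<otimes> p)"
proof -
  obtain U \<phi> where c: "(U, \<phi>) \<in> A" "p \<in> U" using smooth_atlas_cover[OF atlas] .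
  obtain V \<psi> where d: "(V, \<psi>) \<in> A" "a \<otimes> p \<in> V" using smooth_atlas_cover[OF atlas] .
  obtain w where w: "v = coord_tangent A U \<phi> p w" using assms tangent_space_eq_range[OF atlas c] by auto
  show ?thesis
    unfolding tangent_space_eq_range[OF atlas d] w
    by (subst push_coord_tangent[OF atlas atlas smooth_map_translation[of a] smooth_map_translation[of "inv a"] _ _ c d])
       (auto simp: mult_inv_cancel)
qed

definition left_field :: "'g tangent \<Rightarrow> 'g field" where
  "left_field v = (\<lambda>p. push (\<lambda>x. p \<otimes> x) v)"

lemma linear_left_field: "linear left_field"
  by (intro linearI) (simp_all add: left_field_def fun_eq_iff scaleR_fun_def push_def)

lemma left_field_smooth:
  assumes v: "v \<in> tangent_space A \<one>" and W: "open W" and f: "smooth_fun_on A W f"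
  shows "smooth_fun_on A W (\<lambda>p. left_field v p f)"
  unfolding smooth_fun_on_def
proof safe
  fix U \<phi> assume c: "(U, \<phi>) \<in> A"
  obtain V \<psi> where d: "(V, \<psi>) \<in> A" "\<one> \<in> V" using smooth_atlas_cover[OF atlas] .
  obtain w where w: "v = coord_tangent A V \<psi> \<one> w" using v tangent_space_eq_range[OF atlas d] by auto
  let ?F = "\<lambda>z. f (mult_coord U V \<phi> \<psi> z)"
  note dom = mult_dom_def[OF c d(1)] mult_coord_def[OF c d(1)]
  note oS = open_mult_dom[OF c d(1) W]
  have F: "smooth_on (mult_dom U V \<phi> \<psi> W) ?F" by (rule smooth_on_fun_mult_coord[OF c d(1) W f])
  \<comment> \<open>In coordinates, the field applied to \<open>f\<close> is the partial derivative of
    \<open>(p, x) \<mapsto> f (p \<otimes> x)\<close> in the second variable at \<open>x = \<one>\<close>, hence smooth in \<open>p\<close>.\<close>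
  have S: "open (\<phi> ` (U \<inter> W))" by (rule smooth_atlas_chart(3)[OF atlas c W])
  have mem: "(y, \<psi> \<one>) \<in> mult_dom U V \<phi> \<psi> W" if "y \<in> \<phi> ` (U \<inter> W)" for y
    using that by (auto simp: dom smooth_atlas_chart(2)[OF atlas c] smooth_atlas_chart(2)[OF atlas d] mult_one d)
  have s: "smooth_on (\<phi> ` (U \<inter> W)) (\<lambda>y. frechet_derivative ?F (at (y, \<psi> \<one>)) (0, w))"
    by (rule smooth_on_compose[OF S oS _ smooth_on_Pair_const_right[OF S] smooth_on_frechet_derivative[OF F]])
       (use mem in auto)
  have e: "frechet_derivative ?F (at (y, \<psi> \<one>)) (0, w) = left_field v (inv_into U \<phi> y) f"
    if y: "y \<in> \<phi> ` (U \<inter> W)" for y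
  proof -
    let ?p = "inv_into U \<phi> y"
    have "?p \<in> W" using y by (auto simp: smooth_atlas_chart(2)[OF atlas c])
    then have "smooth_near A (?p \<otimes> \<one>) f" using W f by (auto simp: smooth_near_def mult_one)
    \<comment> \<open>Without this, \<open>coord_tangent\<close> at \<open>\<one>\<close> could take
      its default value 0 on the translated function instead of the derivative.\<close>
    then have n: "smooth_near A \<one> (f \<circ> (\<lambda>x. ?p \<otimes> x))"
      by (rule smooth_near_pullback[OF atlas atlas smooth_map_translation])
    have "(?F has_derivative frechet_derivative ?F (at (y, \<psi> \<one>))) (at (y, \<psi> \<one>))"
      using smooth_on_differentiable[OF F oS mem[OF y]] frechet_derivative_works by blast
    moreover have "((\<lambda>x. (y, x)) has_derivative (\<lambda>h. (0, h))) (at (\<psi> \<one>))"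
      by (intro has_derivative_Pair has_derivative_const has_derivative_ident)
    ultimately have "(?F \<circ> (\<lambda>x. (y, x)) has_derivative frechet_derivative ?F (at (y, \<psi> \<one>)) \<circ> (\<lambda>h. (0, h))) (at (\<psi> \<one>))"
      by (intro diff_chain_at)
    moreover have "?F \<circ> (\<lambda>x. (y, x)) = f \<circ> (\<lambda>x. ?p \<otimes> x) \<circ> inv_into V \<psi>"
      by (simp add: fun_eq_iff dom)
    ultimately have "(f \<circ> (\<lambda>x. ?p \<otimes> x) \<circ> inv_into V \<psi> has_derivative
        frechet_derivative ?F (at (y, \<psi> \<one>)) \<circ> (\<lambda>h. (0, h))) (at (\<psi> \<one>))"
      by simp
    from frechet_derivative_at[OF this, symmetric]
    have "frechet_derivative (f \<circ> (\<lambda>x. ?p \<otimes> x) \<circ> inv_into V \<psi>) (at (\<psi> \<one>)) w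
        = frechet_derivative ?F (at (y, \<psi> \<one>)) (0, w)"
      by simp
    then show ?thesis using n by (simp add: left_field_def push_def w coord_tangent_def)
  qed
  have "smooth_on (\<phi> ` (U \<inter> W)) (\<lambda>y. left_field v (inv_into U \<phi> y) f)"
    by (rule smooth_on_cong[OF S e s])
  then show "smooth_on (\<phi> ` (U \<inter> W)) ((\<lambda>p. left_field v p f) \<circ> inv_into U \<phi>)"
    by (simp add: o_def)
qed

lemma left_field_lie_algebra:
  assumes v: "v \<in> tangent_space A \<one>" shows "left_field v \<in> \<nn>"
  using push_translation_tangent[OF v] left_field_smooth[OF v]
  by (simp add: lie_algebra_def vector_fields_def mult_one) (simp add: left_field_def push_def o_def mult_assoc)

lemma lie_algebra_VF: "\<nn> \<subseteq> VF"
  by (auto simp: lie_algebra_def)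

lemma lie_algebra_push:
  assumes "X \<in> \<nn>" shows "X p = push (\<lambda>x. p \<otimes> x) (X \<one>)"
proof -
  have "X (p \<otimes> \<one>) = push (\<lambda>x. p \<otimes> x) (X \<one>)" using assms unfolding lie_algebra_def by blast
  then show ?thesis by (simp only: mult_one)
qed

text \<open>Evaluation at \<open>\<one>\<close> inverts \<open>left_field\<close>. This transports
  the subspace property and a finite spanning set from the tangent space to
  \<open>\<nn>\<close>.\<close>

lemma lie_algebra_eq: "\<nn> = left_field ` tangent_space A \<one>"
proof
  show "\<nn> \<subseteq> left_field ` tangent_space A \<one>"
  proof
    fix X assume X: "X \<in> \<nn>"
    have "X = left_field (X \<one>)" unfolding left_field_def by (rule ext) (rule lie_algebra_push[OF X])
    then show "X \<in> left_field ` tangent_space A \<one>" using X lie_algebra_VF VF_tangent by blast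
  qed
qed (use left_field_lie_algebra in auto)

lemma subspace_lie_algebra: "subspace \<nn>"
  unfolding lie_algebra_eq by (rule linear_subspace_image[OF linear_left_field subspace_tangent_space[OF atlas]])

lemma lie_algebra_finite_span: obtains G where "finite G" "span G = \<nn>"
proof -
  obtain U \<phi> where c: "(U, \<phi>) \<in> A" "\<one> \<in> U" using smooth_atlas_cover[OF atlas] .
  have l: "linear (left_field \<circ> coord_tangent A U \<phi> \<one>)"
    by (rule linear_compose[OF linear_coord_tangent[OF atlas c] linear_left_field])
  have "span ((left_field \<circ> coord_tangent A U \<phi> \<one>) ` Basis) = \<nn>"
    unfolding linear_span_image[OF l] lie_algebra_eq tangent_space_eq_range[OF atlas c] by (simp add: image_comp)
  then show ?thesis using that[OF finite_imageI[OF finite_Basis]] by blast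
qed

text \<open>Translating \<open>u\<close> back to \<open>\<one>\<close> and spreading it by left
  translations recovers \<open>u\<close> at \<open>p\<close>. Thus left-invariant fields are enough
  test vectors at every point.\<close>

lemma lie_algebra_onto_tangent:
  assumes "u \<in> tangent_space A p" obtains X where "X \<in> \<nn>" "X p = u"
proof
  show "left_field (push (\<lambda>x. inv p \<otimes> x) u) \<in> \<nn>"
    using left_field_lie_algebra push_translation_tangent[OF assms, of "inv p"] by (simp add: mult_inv)
  show "left_field (push (\<lambda>x. inv p \<otimes> x) u) p = u"
    by (simp add: left_field_def push_push mult_inv_cancel push_ident)
qed

end

section \<open>Dual families for a bilinear form\<close>

text \<open>Nondegeneracy is kept out of the locale because \<open>dual_family\<close> needs it
  between two different subspaces, in the form of a separate hypothesis.\<close>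

locale inner_space =
  fixes n :: "'a::real_vector set" and B :: "'a \<Rightarrow> 'a \<Rightarrow> real"
  assumes subspace_n: "subspace n"
    and linear_left: "x \<in> n \<Longrightarrow> y \<in> n \<Longrightarrow> z \<in> n \<Longrightarrow> B (a *\<^sub>R x + b *\<^sub>R y) z = a * B x z + b * B y z"
    and sym: "x \<in> n \<Longrightarrow> y \<in> n \<Longrightarrow> B x y = B y x"
begin

lemma zero_left: "z \<in> n \<Longrightarrow> B 0 z = 0"
  using linear_left[of z z z 0 0] by simp

lemma scale_left: "x \<in> n \<Longrightarrow> z \<in> n \<Longrightarrow> B (a *\<^sub>R x) z = a * B x z"
  using linear_left[of x x z a 0] by simp

lemma add_left: "x \<in> n \<Longrightarrow> y \<in> n \<Longrightarrow> z \<in> n \<Longrightarrow> B (x + y) z = B x z + B y z"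
  using linear_left[of x y z 1 1] by simp

lemma diff_left: "x \<in> n \<Longrightarrow> y \<in> n \<Longrightarrow> z \<in> n \<Longrightarrow> B (x - y) z = B x z - B y z"
  using linear_left[of x y z 1 "-1"] by simp

lemma sum_left:
  "(\<And>i. i \<in> I \<Longrightarrow> x i \<in> n) \<Longrightarrow> z \<in> n \<Longrightarrow> B (\<Sum>i\<in>I. a i *\<^sub>R x i) z = (\<Sum>i\<in>I. a i * B (x i) z)"
proof (induction I rule: infinite_finite_induct)
  case (insert i I)
  then show ?case
    by (simp add: add_left scale_left subspace_n subspace_scale subspace_sum)
qed (simp_all add: zero_left)

lemmas n_closed = subspace_0[OF subspace_n] subspace_add[OF subspace_n] subspace_diff[OF subspace_n]
  subspace_scale[OF subspace_n] subspace_sum[OF subspace_n]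

lemma diff_right: "x \<in> n \<Longrightarrow> y \<in> n \<Longrightarrow> z \<in> n \<Longrightarrow> B z (x - y) = B z x - B z y"
  using diff_left[of x y z] by (simp add: sym n_closed)

lemma sum_right:
  "(\<And>i. i \<in> I \<Longrightarrow> x i \<in> n) \<Longrightarrow> z \<in> n \<Longrightarrow> B z (\<Sum>i\<in>I. a i *\<^sub>R x i) = (\<Sum>i\<in>I. a i * B z (x i))"
  using sum_left[of I x z a] by (simp add: sym n_closed)

text \<open>An indefinite form rules out plain Gram-Schmidt, since vectors may be null. The dual
  vectors are instead found in a second space \<open>U\<close> and corrected each time a vector
  joins \<open>F\<close>. It serves twice: with \<open>U\<close> all of \<open>\<nn>\<close> to
  build frames, and with \<open>U\<close> the null part of the center against a basis of
  \<open>V\<close>.\<close>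

lemma dual_family:
  assumes U: "subspace U" "U \<subseteq> n" and F: "finite F" "independent F" "F \<subseteq> n"
    and nd: "\<And>v. v \<in> span F \<Longrightarrow> (\<forall>u\<in>U. B u v = 0) \<Longrightarrow> v = 0"
  shows "\<exists>d. (\<forall>c\<in>F. d c \<in> U) \<and> (\<forall>c\<in>F. \<forall>c'\<in>F. B (d c) c' = (if c = c' then 1 else 0))"
  using F nd
proof (induction F rule: finite_induct)
  case (insert c F)
  have sp: "span F \<subseteq> span (insert c F)" by (rule span_mono) auto
  have cF: "c \<notin> span F" using insert.prems(1) insert.hyps by (simp add: independent_insert)
  have n: "c \<in> n" "\<And>f. f \<in> F \<Longrightarrow> f \<in> n" using insert.prems by auto
  obtain d where d: "\<And>f. f \<in> F \<Longrightarrow> d f \<in> U" "\<And>f f'. f \<in> F \<Longrightarrow> f' \<in> F \<Longrightarrow> B (d f) f' = (if f = f' then 1 else 0)"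
    using insert.IH insert.prems sp independent_mono[OF insert.prems(1)] by (metis insert_subset subset_iff subset_insertI)
  have dn: "d f \<in> n" if "f \<in> F" for f using d(1)[OF that] U by auto
  \<comment> \<open>Chosen so that \<open>c - s\<close> is orthogonal to every \<open>d f\<close>.
    It is nonzero because \<open>c\<close> is outside \<open>span F\<close>, so \<open>nd\<close>
    yields some \<open>u\<close> in \<open>U\<close> that detects it.\<close>
  define s where "s = (\<Sum>f\<in>F. B (d f) c *\<^sub>R f)"
  have s: "s \<in> span F" unfolding s_def by (intro span_sum span_scale span_base)
  have sn: "s \<in> n" unfolding s_def using n by (intro n_closed)
  have "c - s \<noteq> 0" using s cF by auto
  moreover have "c - s \<in> span (insert c F)" using s sp by (auto intro: span_diff span_base)
  ultimately obtain u where u: "u \<in> U" "B u (c - s) \<noteq> 0" using insert.prems(3) by blast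
  have un: "u \<in> n" using u U by auto
  \<comment> \<open>\<open>t\<close> has the same pairings with \<open>F\<close> as
    \<open>u\<close>, so \<open>u - t\<close> vanishes on \<open>F\<close>. Its pairing with
    \<open>c\<close> is \<open>B u (c - s)\<close>, which is nonzero; rescaling gives the dual
    vector \<open>w\<close> of \<open>c\<close>.\<close>
  define t where "t = (\<Sum>f\<in>F. B u f *\<^sub>R d f)"
  have t: "t \<in> U" unfolding t_def using d by (intro subspace_sum[OF U(1)] subspace_scale[OF U(1)])
  then have tn: "t \<in> n" using U by auto
  have tc: "B t c = B u s"
    unfolding t_def s_def using n un dn by (simp add: sum_left sum_right mult.commute)
  have tf: "B t f = B u f" if "f \<in> F" for f
  proof -
    have "B t f = (\<Sum>f'\<in>F. B u f' * B (d f') f)"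
      unfolding t_def using n dn that by (simp add: sum_left)
    also have "\<dots> = (\<Sum>f'\<in>F. if f' = f then B u f' else 0)" using d(2) that by (intro sum.cong) auto
    finally show ?thesis using insert.hyps that by simp
  qed
  define b where "b = B (u - t) c"
  have b: "b \<noteq> 0" using u(2) un tn n sn by (simp add: b_def diff_left diff_right tc)
  define w where "w = (1 / b) *\<^sub>R (u - t)"
  have w: "w \<in> U" unfolding w_def using u t by (intro subspace_diff[OF U(1)] subspace_scale[OF U(1)])
  then have wn: "w \<in> n" using U by auto
  have wc: "B w c = 1" using b n un tn by (simp add: w_def scale_left n_closed b_def)
  have wf: "B w f = 0" if "f \<in> F" for f using tf[OF that] n(2)[OF that] un tn by (simp add: w_def scale_left diff_left n_closed)
  \<comment> \<open>The old dual vectors may still pair with \<open>c\<close>. Subtracting a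
    multiple of \<open>w\<close> removes this and changes nothing on \<open>F\<close>.\<close>
  define d' where "d' f = (if f = c then w else d f - B (d f) c *\<^sub>R w)" for f
  have "d' f \<in> U" if "f \<in> insert c F" for f
    using that w d(1) subspace_diff[OF U(1)] subspace_scale[OF U(1)] by (auto simp: d'_def)
  moreover have "B (d' f) f' = (if f = f' then 1 else 0)" if "f \<in> insert c F" "f' \<in> insert c F" for f f'
    using that wn wc wf d(2) dn n insert.hyps
    by (auto simp: d'_def diff_left scale_left n_closed)
  ultimately show ?case by blast
qed auto

end

section \<open>Left-invariant metrics and the Koszul formula\<close>

text \<open>That left-invariant fields are closed under brackets holds in every Lie group.  It is
  assumed here because in the theorem it follows at once from \<open>[\<nn>, \<nn>] \<subseteq> \<UU>\<close>,
  and it avoids the symmetry of second derivatives.\<close>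

locale metric_lie_grp = lie_grp A N
  for A :: "('g::topological_space, 'e::euclidean_space) chart set" and N :: "'g monoid" (structure) +
  fixes g :: "'g \<Rightarrow> 'g tangent \<Rightarrow> 'g tangent \<Rightarrow> real"
  assumes metric: "pseudo_riemannian_metric A g"
    and left_invariant: "left_invariant_metric A N g"
    and bracket_lie_algebra: "X \<in> \<nn> \<Longrightarrow> Y \<in> \<nn> \<Longrightarrow> bracket X Y \<in> \<nn>"
begin

definition gf :: "'g field \<Rightarrow> 'g field \<Rightarrow> 'g \<Rightarrow> real" where
  "gf X Y = (\<lambda>p. g p (X p) (Y p))"

abbreviation "inn \<equiv> lie_inner N g"

lemma inner_space_tangent: "inner_space (tangent_space A p) (g p)"
  using metric subspace_tangent_space[OF atlas]
  by unfold_locales (auto simp: pseudo_riemannian_metric_def)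

lemma gf_smooth: "X \<in> VF \<Longrightarrow> Y \<in> VF \<Longrightarrow> smooth_fun (gf X Y)"
  using metric by (simp add: pseudo_riemannian_metric_def gf_def)

lemma gf_sym: "X \<in> VF \<Longrightarrow> Y \<in> VF \<Longrightarrow> gf X Y = gf Y X"
  using inner_space.sym[OF inner_space_tangent] VF_tangent by (auto simp: gf_def)

lemma gf_add: "X \<in> VF \<Longrightarrow> Y \<in> VF \<Longrightarrow> Z \<in> VF \<Longrightarrow> gf (X + Y) Z = (\<lambda>p. gf X Z p + gf Y Z p)"
  using inner_space.add_left[OF inner_space_tangent] VF_tangent by (simp add: gf_def)

lemma gf_diff: "X \<in> VF \<Longrightarrow> Y \<in> VF \<Longrightarrow> Z \<in> VF \<Longrightarrow> gf (X - Y) Z = (\<lambda>p. gf X Z p - gf Y Z p)"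
  using inner_space.diff_left[OF inner_space_tangent] VF_tangent by (simp add: gf_def)

lemma gf_fscale: "X \<in> VF \<Longrightarrow> Z \<in> VF \<Longrightarrow> gf (f \<odot> X) Z = (\<lambda>p. f p * gf X Z p)"
  using inner_space.scale_left[OF inner_space_tangent] VF_tangent by (simp add: gf_def)

lemma gf_add_right: "X \<in> VF \<Longrightarrow> Y \<in> VF \<Longrightarrow> Z \<in> VF \<Longrightarrow> gf Z (X + Y) = (\<lambda>p. gf Z X p + gf Z Y p)"
  using gf_add[of X Y Z] by (simp add: gf_sym VF_add)

lemma gf_fscale_right:
  "X \<in> VF \<Longrightarrow> Z \<in> VF \<Longrightarrow> smooth_fun f \<Longrightarrow> gf Z (f \<odot> X) = (\<lambda>p. f p * gf Z X p)"
  using gf_fscale[of X Z f] gf_sym[of Z "f \<odot> X"] gf_sym[of Z X] by (simp add: VF_fscale)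

lemma gf_linear_right:
  assumes "X \<in> VF" "Y \<in> VF" "Z \<in> VF" shows "gf Z (a *\<^sub>R X + Y) p = a * gf Z X p + gf Z Y p"
  using gf_add_right[OF VF_scaleR[OF assms(1)] assms(2,3)]
    gf_fscale_right[OF assms(1,3) smooth_fun_on_const, of a] unfolding scaleR_eq_fscale by simp

lemma gf_zero_right: "Z \<in> VF \<Longrightarrow> gf Z 0 = (\<lambda>p. 0)"
  using gf_fscale_right[OF VF_zero _ smooth_fun_on_const[of A UNIV 0], of Z] scaleR_eq_fscale[of 0 0] by simp

lemma gf_const:
  assumes "X \<in> \<nn>" "Y \<in> \<nn>" shows "gf X Y = (\<lambda>p. inn X Y)"
proof
  fix p
  have "g (p \<otimes> \<one>) (push (\<lambda>x. p \<otimes> x) (X \<one>)) (push (\<lambda>x. p \<otimes> x) (Y \<one>)) = g \<one> (X \<one>) (Y \<one>)"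
    using left_invariant assms lie_algebra_VF VF_tangent unfolding left_invariant_metric_def by blast
  then show "gf X Y p = inn X Y"
    by (simp only: gf_def lie_inner_def mult_one lie_algebra_push[OF assms(1), of p] lie_algebra_push[OF assms(2), of p])
qed

lemma inner_space_lie_algebra: "inner_space \<nn> inn"
proof
  show "subspace \<nn>" by (rule subspace_lie_algebra)
  show "inn (a *\<^sub>R X + b *\<^sub>R Y) Z = a * inn X Z + b * inn Y Z" if "X \<in> \<nn>" "Y \<in> \<nn>" "Z \<in> \<nn>" for X Y Z a b
    using inner_space.linear_left[OF inner_space_tangent] that lie_algebra_VF VF_tangent
    by (simp add: lie_inner_def scaleR_fun_def[of _ "X :: 'g field"] scaleR_fun_def[of _ "Y :: 'g field"] subset_iff)
  show "inn X Y = inn Y X" if "X \<in> \<nn>" "Y \<in> \<nn>" for X Y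
    using inner_space.sym[OF inner_space_tangent] that lie_algebra_VF VF_tangent
    by (simp add: lie_inner_def subset_iff)
qed

sublocale n: inner_space \<nn> inn by (rule inner_space_lie_algebra)

lemma tangent_nondegenerate:
  assumes "u \<in> tangent_space A p" "\<And>X. X \<in> \<nn> \<Longrightarrow> g p u (X p) = 0" shows "u = 0"
proof -
  have "g p u v = 0" if "v \<in> tangent_space A p" for v
    using lie_algebra_onto_tangent[OF that] assms(2) by metis
  then show ?thesis using metric assms(1) unfolding pseudo_riemannian_metric_def by blast
qed

text \<open>Vector fields take two arguments; these rules would unfold sums of fields pointwise.\<close>
declare plus_fun_apply [simp del] zero_fun_apply [simp del]

lemma VF_eqI:
  assumes "X \<in> VF" "Y \<in> VF" "\<And>Z p. Z \<in> VF \<Longrightarrow> gf X Z p = gf Y Z p"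
  shows "X = Y"
proof
  fix p
  have "X p - Y p = 0"
  proof (rule tangent_nondegenerate)
    show "X p - Y p \<in> tangent_space A p"
      using assms VF_tangent subspace_diff[OF subspace_tangent_space[OF atlas]] by blast
    fix Z assume "Z \<in> \<nn>"
    then have Z: "Z \<in> VF" using lie_algebra_VF by auto
    have "gf (X - Y) Z p = 0" using assms(3)[OF Z] gf_diff[OF assms(1,2) Z] by simp
    then show "g p (X p - Y p) (Z p) = 0" by (simp add: gf_def)
  qed
  then show "X p = Y p" by simp
qed

text \<open>\<open>inn\<close> sees only the fibre at \<open>\<one>\<close>, but pairings of
  left-invariant fields are constant, so vanishing there forces vanishing in every fibre.\<close>

lemma inn_nondegenerate:
  assumes "X \<in> \<nn>" "\<And>Y. Y \<in> \<nn> \<Longrightarrow> inn X Y = 0" shows "X = 0"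
proof
  fix p
  have X: "X \<in> VF" using assms(1) lie_algebra_VF by auto
  have "g p (X p) (Y p) = 0" if "Y \<in> \<nn>" for Y
    using gf_const[OF assms(1) that] assms(2)[OF that] by (simp add: gf_def fun_eq_iff)
  then have "X p = 0" by (rule tangent_nondegenerate[OF VF_tangent[OF X]])
  then show "X p = 0 p" by (simp add: zero_fun_apply)
qed

text \<open>The duality makes the functions \<open>gf X c\<close> the coefficients of a field
  \<open>X\<close> along the fields \<open>d c\<close>, which is the role an orthonormal frame plays
  for a definite metric.\<close>

definition dual_frame :: "'g field set \<Rightarrow> ('g field \<Rightarrow> 'g field) \<Rightarrow> bool" where
  "dual_frame C d \<longleftrightarrow> finite C \<and> C \<subseteq> \<nn> \<and> span C = \<nn> \<and> (\<forall>c\<in>C. d c \<in> \<nn>) \<and>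
     (\<forall>c\<in>C. \<forall>c'\<in>C. inn (d c) c' = (if c = c' then 1 else 0))"

lemma dual_frameD:
  assumes "dual_frame C d"
  shows "finite C" "C \<subseteq> \<nn>" "span C = \<nn>" "\<And>c. c \<in> C \<Longrightarrow> d c \<in> \<nn>"
    "\<And>c c'. c \<in> C \<Longrightarrow> c' \<in> C \<Longrightarrow> inn (d c) c' = (if c = c' then 1 else 0)"
  using assms by (auto simp: dual_frame_def)

lemma dual_frame_exists: obtains C d where "dual_frame C d"
proof -
  obtain G where G: "finite G" "span G = \<nn>" by (rule lie_algebra_finite_span)
  obtain C where C: "C \<subseteq> G" "independent C" "G \<subseteq> span C" by (rule maximal_independent_subset)
  have s: "span C = \<nn>" using C G span_mono span_minimal[OF C(3) subspace_span] by (metis subset_antisym)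
  have "C \<subseteq> \<nn>" using s span_superset by auto
  moreover have "\<exists>d. (\<forall>c\<in>C. d c \<in> \<nn>) \<and> (\<forall>c\<in>C. \<forall>c'\<in>C. inn (d c) c' = (if c = c' then 1 else 0))"
  proof (rule n.dual_family[OF subspace_lie_algebra order_refl _ C(2) \<open>C \<subseteq> \<nn>\<close>])
    show "finite C" using C G finite_subset by blast
    show "v = 0" if "v \<in> span C" "\<forall>u\<in>\<nn>. inn u v = 0" for v
      using that inn_nondegenerate[of v] n.sym s by metis
  qed
  ultimately show ?thesis using that[of C] s C G finite_subset unfolding dual_frame_def by metis
qed

lemma gf_sum_left:
  assumes "\<And>i. i \<in> I \<Longrightarrow> X i \<in> VF" "Z \<in> VF"
  shows "gf (\<lambda>p. \<Sum>i\<in>I. f i p *\<^sub>R X i p) Z p = (\<Sum>i\<in>I. f i p * gf (X i) Z p)"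
  unfolding gf_def using assms VF_tangent by (intro inner_space.sum_left[OF inner_space_tangent]) auto

lemma VF_sum_fscale:
  assumes "\<And>i. i \<in> I \<Longrightarrow> X i \<in> VF" "\<And>i. i \<in> I \<Longrightarrow> smooth_fun (f i)"
  shows "(\<lambda>p. \<Sum>i\<in>I. f i p *\<^sub>R X i p) \<in> VF"
proof -
  have "(\<Sum>i\<in>I. f i \<odot> X i) \<in> VF" using assms by (intro VF_sum VF_fscale)
  also have "(\<Sum>i\<in>I. f i \<odot> X i) = (\<lambda>p. \<Sum>i\<in>I. f i p *\<^sub>R X i p)"
    by (induction I rule: infinite_finite_induct) (simp_all add: fun_eq_iff plus_fun_apply zero_fun_apply)
  finally show ?thesis .
qed

text \<open>The difference of the two sides pairs to 0 with each \<open>c\<close>, hence with all of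
  \<open>\<nn>\<close>. The coefficients are smooth on the whole group, so no localisation is
  involved.\<close>

lemma frame_expansion:
  assumes Cd: "dual_frame C d" and X: "X \<in> VF"
  shows "X = (\<lambda>p. \<Sum>c\<in>C. gf X c p *\<^sub>R d c p)" (is "X = ?Y")
proof
  note C = dual_frameD[OF Cd]
  fix p
  have dV: "d c \<in> VF" "c \<in> VF" if "c \<in> C" for c using C(2,4) that lie_algebra_VF by auto
  have Y: "?Y \<in> VF" by (intro VF_sum_fscale dV gf_smooth X)
  define W where "W = X - ?Y"
  have W: "W \<in> VF" unfolding W_def by (rule VF_diff[OF X Y])
  have "W p = 0"
  proof (rule tangent_nondegenerate[OF VF_tangent[OF W]])
    have 1: "gf W c p = 0" if c: "c \<in> C" for c
    proof -
      have "gf ?Y c p = (\<Sum>c'\<in>C. gf X c' p * gf (d c') c p)" using dV c by (intro gf_sum_left) auto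
      also have "\<dots> = (\<Sum>c'\<in>C. if c' = c then gf X c' p else 0)"
        using C(2,4,5) c by (intro sum.cong refl) (auto simp: gf_const subset_iff)
      finally have "gf ?Y c p = gf X c p" using C(1) c by simp
      then show ?thesis using gf_diff[OF X Y dV(2)[OF c]] by (simp add: W_def)
    qed
    fix Z assume "Z \<in> \<nn>"
    then have "Z \<in> span C" using C(3) by simp
    then have "Z \<in> VF \<and> gf W Z p = 0"
    proof (induction Z rule: span_induct_alt)
      case base
      show ?case using gf_zero_right[OF W] VF_zero by simp
    next
      case (step a c Z)
      then show ?case using 1[of c] dV(2)[of c] gf_linear_right[of c Z W a p] W by (simp add: VF_add VF_scaleR)
    qed
    then show "g p (W p) (Z p) = 0" by (simp add: gf_def)
  qed
  then show "X p = ?Y p" by (simp add: W_def)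
qed

text \<open>\<open>frame_expansion\<close> in the form of an induction rule: properties stable under
  sums and under smooth multiples need checking on \<open>\<nn>\<close> only.\<close>

lemma VF_induct [consumes 1, case_names left_invariant fscale add]:
  assumes "X \<in> VF" and inv: "\<And>Y. Y \<in> \<nn> \<Longrightarrow> P Y"
    and fscale: "\<And>f Y. smooth_fun f \<Longrightarrow> Y \<in> VF \<Longrightarrow> P Y \<Longrightarrow> P (f \<odot> Y)"
    and add: "\<And>Y Z. Y \<in> VF \<Longrightarrow> Z \<in> VF \<Longrightarrow> P Y \<Longrightarrow> P Z \<Longrightarrow> P (Y + Z)"
  shows "P X"
proof -
  obtain C d where Cd: "dual_frame C d" by (rule dual_frame_exists)
  note C = dual_frameD[OF Cd]
  have V: "d c \<in> VF" "c \<in> VF" if "c \<in> C" for c using C(2,4) that lie_algebra_VF by auto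
  have "P (\<Sum>c\<in>I. gf X c \<odot> d c) \<and> (\<Sum>c\<in>I. gf X c \<odot> d c) \<in> VF" if "finite I" "I \<subseteq> C" for I
    using that
  proof (induction I rule: finite_induct)
    case empty
    show ?case using inv[of 0] subspace_0[OF subspace_lie_algebra] lie_algebra_VF by auto
  next
    case (insert c I)
    have c: "c \<in> C" using insert.prems by auto
    have 1: "gf X c \<odot> d c \<in> VF" by (intro VF_fscale gf_smooth V c assms(1))
    have 2: "P (gf X c \<odot> d c)" by (intro fscale gf_smooth V c assms(1) inv C(4))
    have 3: "P (\<Sum>c\<in>I. gf X c \<odot> d c)" "(\<Sum>c\<in>I. gf X c \<odot> d c) \<in> VF" using insert by auto
    show ?case unfolding sum.insert[OF insert.hyps] using add[OF 1 3(2) 2 3(1)] VF_add[OF 1 3(2)] by blast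
  qed
  then have "P (\<Sum>c\<in>C. gf X c \<odot> d c)" using C(1) by blast
  moreover have "(\<Sum>c\<in>I. gf X c \<odot> d c) = (\<lambda>p. \<Sum>c\<in>I. gf X c p *\<^sub>R d c p)" for I
    by (induction I rule: infinite_finite_induct) (simp_all add: fun_eq_iff plus_fun_apply zero_fun_apply)
  ultimately show ?thesis using frame_expansion[OF Cd assms(1)] by simp
qed

text \<open>A field with constant coefficients along the frame is a real linear combination of
  left-invariant fields. This is how covariant derivatives are recognised as elements of
  \<open>\<nn>\<close>.\<close>

lemma lie_algebra_const_coeffs:
  assumes X: "X \<in> VF" and c: "\<And>Z p. Z \<in> \<nn> \<Longrightarrow> gf X Z p = gf X Z \<one>" shows "X \<in> \<nn>"
proof -
  obtain C d where Cd: "dual_frame C d" by (rule dual_frame_exists)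
  note C = dual_frameD[OF Cd]
  have "X = (\<lambda>p. \<Sum>c\<in>C. gf X c p *\<^sub>R d c p)" by (rule frame_expansion[OF Cd X])
  also have "\<dots> = (\<lambda>p. \<Sum>c\<in>C. gf X c \<one> *\<^sub>R d c p)"
  proof -
    have "gf X z p = gf X z \<one>" if "z \<in> C" for z p using that C(2) by (intro c) auto
    from arg_cong2[where f = scaleR, OF this refl] show ?thesis by - (rule ext, rule sum.cong[OF refl])
  qed
  also have "\<dots> = (\<Sum>c\<in>C. gf X c \<one> *\<^sub>R d c)"
    by (induction C rule: infinite_finite_induct) (simp_all add: fun_eq_iff scaleR_fun_def plus_fun_apply zero_fun_apply)
  finally have e: "X = (\<Sum>c\<in>C. gf X c \<one> *\<^sub>R d c)" .
  have "(\<Sum>c\<in>C. gf X c \<one> *\<^sub>R d c) \<in> \<nn>" using C(4) by (intro n.n_closed)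
  then show ?thesis by (simp only: e[symmetric])
qed

text \<open>The representing field is forced by duality: its coefficient along \<open>d c\<close>
  must be \<open>k c\<close>. Linearity of \<open>k\<close> over smooth functions then extends the
  identity from \<open>C\<close> to all fields.\<close>

lemma riesz:
  assumes sm: "\<And>Z. Z \<in> VF \<Longrightarrow> smooth_fun (k Z)"
    and add: "\<And>Y Z. Y \<in> VF \<Longrightarrow> Z \<in> VF \<Longrightarrow> k (Y + Z) = (\<lambda>p. k Y p + k Z p)"
    and fs: "\<And>f Z. smooth_fun f \<Longrightarrow> Z \<in> VF \<Longrightarrow> k (f \<odot> Z) = (\<lambda>p. f p * k Z p)"
  shows "\<exists>W\<in>VF. \<forall>Z\<in>VF. gf W Z = k Z"
proof -
  obtain C d where Cd: "dual_frame C d" by (rule dual_frame_exists)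
  note C = dual_frameD[OF Cd]
  have V: "d c \<in> VF" "c \<in> VF" if "c \<in> C" for c using C(2,4) that lie_algebra_VF by auto
  define W where "W = (\<lambda>p. \<Sum>c\<in>C. k c p *\<^sub>R d c p)"
  have W: "W \<in> VF" unfolding W_def by (intro VF_sum_fscale V sm)
  have comb: "k (a *\<^sub>R Y + Z) = (\<lambda>p. a * k Y p + k Z p)" if "Y \<in> VF" "Z \<in> VF" for a Y Z
    using add[OF VF_scaleR[OF that(1)] that(2)] fs[OF smooth_fun_on_const that(1), of a]
    unfolding scaleR_eq_fscale by simp
  have gC: "gf W c = k c" if c: "c \<in> C" for c
  proof
    fix p
    have "gf W c p = (\<Sum>c'\<in>C. k c' p * gf (d c') c p)" unfolding W_def using V c by (intro gf_sum_left) auto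
    also have "\<dots> = (\<Sum>c'\<in>C. if c' = c then k c' p else 0)"
      using C(2,4,5) c by (intro sum.cong refl) (auto simp: gf_const subset_iff)
    finally show "gf W c p = k c p" using C(1) c by simp
  qed
  have "gf W Z = k Z" if "Z \<in> VF" for Z
    using that
  proof (induction Z rule: VF_induct)
    case (left_invariant Z)
    then have "Z \<in> span C" using C(3) by simp
    then have "Z \<in> VF \<and> gf W Z = k Z"
    proof (induction Z rule: span_induct_alt)
      case base
      have "k 0 = (\<lambda>p. 0)" using fs[OF smooth_fun_on_const VF_zero, of 0] scaleR_eq_fscale[of 0 0] by simp
      then show ?case using VF_zero gf_zero_right[OF W] by simp
    next
      case (step a c Z)
      then show ?case using gC[of c] V(2)[of c] gf_linear_right[of c Z W a] comb[of c Z a] W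
        by (simp add: VF_add VF_scaleR fun_eq_iff)
    qed
    then show ?case by simp
  next
    case (fscale f Z)
    then show ?case by (simp add: gf_fscale_right W fs)
  next
    case (add Y Z)
    then show ?case by (simp add: gf_add_right W assms(2))
  qed
  then show ?thesis using W by blast
qed

lemma VF_deriv: "X \<in> VF \<Longrightarrow> smooth_fun f \<Longrightarrow> smooth_fun (\<lambda>p. X p f)"
  by (rule VF_smooth) auto

text \<open>The substance is that a commutator is again a first-order operator. It is available on
  \<open>\<nn>\<close>, and the Leibniz rules carry it to both arguments.\<close>

lemma bracket_VF:
  assumes "X \<in> VF" "Y \<in> VF" shows "bracket X Y \<in> VF"
  using assms(1)
proof (induction X rule: VF_induct)
  case (left_invariant X)
  then have X: "X \<in> VF" using lie_algebra_VF by auto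
  show ?case using assms(2)
  proof (induction Y rule: VF_induct)
    case (left_invariant Y)
    then show ?case using bracket_lie_algebra[OF \<open>X \<in> \<nn>\<close>] lie_algebra_VF by auto
  next
    case (fscale f Y)
    then show ?case unfolding bracket_fscale_right[OF X fscale(2,1)]
      by (intro VF_add VF_fscale VF_deriv[OF X])
  next
    case (add Y Z)
    then show ?case using X by (simp add: bracket_add_right VF_add)
  qed
next
  case (fscale f X)
  then show ?case unfolding bracket_fscale[OF fscale(2) assms(2) fscale(1)]
    by (intro VF_diff VF_fscale VF_deriv[OF assms(2)])
next
  case (add X Z)
  then show ?case using assms(2) by (simp add: bracket_add VF_add)
qed

end

section \<open>Existence of the Levi-Civita connection from Koszul's formula\<close>

context metric_lie_grp
begin

lemma scaleR_apply: "(c *\<^sub>R v) f = c *\<^sub>R v f" for v :: "'g tangent"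
  by (simp add: scaleR_fun_def)

lemma VF_deriv_add:
  assumes "X \<in> VF" "smooth_fun f" "smooth_fun h" shows "X p (\<lambda>q. f q + h q) = X p f + X p h"
  using tangent_add[OF atlas VF_tangent smooth_fun_near smooth_fun_near] assms by blast

lemma VF_deriv_mult:
  assumes "X \<in> VF" "smooth_fun f" "smooth_fun h" shows "X p (\<lambda>q. f q * h q) = f p * X p h + X p f * h p"
  using tangent_mult[OF atlas VF_tangent smooth_fun_near smooth_fun_near] assms by blast

text \<open>The right side of Koszul's formula: twice the pairing of the covariant derivative of
  \<open>Y\<close> along \<open>X\<close> with \<open>Z\<close>.\<close>

definition koszul :: "'g field \<Rightarrow> 'g field \<Rightarrow> 'g field \<Rightarrow> 'g \<Rightarrow> real" where
  "koszul X Y Z p = X p (gf Y Z) + Y p (gf Z X) - Z p (gf X Y)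
     + gf (bracket X Y) Z p - gf (bracket Y Z) X p + gf (bracket Z X) Y p"

lemma koszul_smooth:
  assumes "X \<in> VF" "Y \<in> VF" "Z \<in> VF" shows "smooth_fun (koszul X Y Z)"
  unfolding koszul_def[abs_def] using assms
  by (intro smooth_fun_on_add[OF atlas open_UNIV] smooth_fun_on_diff[OF atlas open_UNIV] VF_deriv[OF assms(1)]
      VF_deriv[OF assms(2)] VF_deriv[OF assms(3)] gf_smooth bracket_VF)

lemma gf_bracket_skew:
  assumes "X \<in> VF" "Y \<in> VF" "Z \<in> VF" shows "gf (bracket Y X) Z p = - gf (bracket X Y) Z p"
proof -
  have "bracket Y X = (\<lambda>p. -1) \<odot> bracket X Y" using bracket_skew[of Y X] by (simp add: fun_eq_iff)
  then show ?thesis using gf_fscale[OF bracket_VF[OF assms(1,2)] assms(3), of "\<lambda>p. -1"] by simp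
qed

text \<open>Symmetry of the metric cancels the derivative terms, and skewness of the bracket all but
  one bracket term. Read through \<open>nabla\<close>, this is torsion freeness, as
  \<open>koszul_metric\<close> is metric compatibility.\<close>

lemma koszul_torsion:
  assumes "X \<in> VF" "Y \<in> VF" "Z \<in> VF"
  shows "koszul X Y Z p - koszul Y X Z p = 2 * gf (bracket X Y) Z p"
  using assms gf_bracket_skew[of X Y Z p] gf_bracket_skew[of X Z Y p] gf_bracket_skew[of Y Z X p]
  by (simp add: koszul_def gf_sym[of X Y] gf_sym[of Z Y] gf_sym[of Z X])

lemma koszul_metric:
  assumes "X \<in> VF" "Y \<in> VF" "Z \<in> VF"
  shows "koszul X Y Z p + koszul X Z Y p = 2 * X p (gf Y Z)"
  using assms gf_bracket_skew[of X Y Z p] gf_bracket_skew[of X Z Y p] gf_bracket_skew[of Y Z X p]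
  by (simp add: koszul_def gf_sym[of X Y] gf_sym[of Z Y] gf_sym[of Z X])

lemma koszul_add:
  assumes "X \<in> VF" "Y \<in> VF" "Z \<in> VF" "W \<in> VF"
  shows "koszul X Y (Z + W) p = koszul X Y Z p + koszul X Y W p"
  using assms
  by (simp add: koszul_def gf_add gf_add_right bracket_add bracket_add_right VF_deriv_add gf_smooth bracket_VF
      VF_add plus_fun_apply)

text \<open>The derivatives of \<open>f\<close> along \<open>X\<close> and \<open>Y\<close> arise
  once from the metric terms and once, with opposite sign, from the brackets. Their cancellation is
  what makes \<open>riesz\<close> applicable in the last slot.\<close>

lemma koszul_fscale:
  assumes "X \<in> VF" "Y \<in> VF" "Z \<in> VF" "smooth_fun f"
  shows "koszul X Y (f \<odot> Z) p = f p * koszul X Y Z p"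
  using assms
  by (simp add: koszul_def gf_add gf_diff gf_fscale gf_fscale_right bracket_fscale bracket_fscale_right
      VF_deriv_mult gf_smooth bracket_VF VF_add VF_fscale VF_deriv scaleR_apply gf_sym[of Z Y] gf_sym[of Z X]
      algebra_simps)

definition nabla :: "'g field \<Rightarrow> 'g field \<Rightarrow> 'g field" where
  "nabla X Y = (SOME W. W \<in> VF \<and> (\<forall>Z\<in>VF. \<forall>p. 2 * gf W Z p = koszul X Y Z p))"

lemma nabla:
  assumes "X \<in> VF" "Y \<in> VF"
  shows "nabla X Y \<in> VF" "Z \<in> VF \<Longrightarrow> 2 * gf (nabla X Y) Z p = koszul X Y Z p"
proof -
  have "\<exists>W\<in>VF. \<forall>Z\<in>VF. gf W Z = (\<lambda>p. 1 / 2 * koszul X Y Z p)"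
    using assms
    by (intro riesz) (simp_all add: koszul_add koszul_fscale add_divide_distrib
        smooth_fun_on_mult[OF atlas open_UNIV smooth_fun_on_const[of A UNIV "1 / 2"] koszul_smooth, simplified])
  then have "\<exists>W. W \<in> VF \<and> (\<forall>Z\<in>VF. \<forall>p. 2 * gf W Z p = koszul X Y Z p)" by auto
  from someI_ex[OF this] show "nabla X Y \<in> VF" "Z \<in> VF \<Longrightarrow> 2 * gf (nabla X Y) Z p = koszul X Y Z p"
    unfolding nabla_def by blast+
qed

lemma nabla_eqI:
  assumes "X \<in> VF" "Y \<in> VF" "W \<in> VF" "\<And>Z p. Z \<in> VF \<Longrightarrow> koszul X Y Z p = 2 * gf W Z p"
  shows "nabla X Y = W"
  using nabla[OF assms(1,2)] assms(3,4) by (intro VF_eqI) auto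

text \<open>Only the last slot is expanded directly. \<open>koszul_metric\<close> carries its
  linearity to the middle slot, and \<open>koszul_torsion\<close> carries it from there to the
  first.\<close>

lemma koszul_add_middle:
  assumes "X \<in> VF" "Y \<in> VF" "Z \<in> VF" "W \<in> VF"
  shows "koszul X (Y + W) Z p = koszul X Y Z p + koszul X W Z p"
  using koszul_metric[of X "Y + W" Z p] koszul_metric[of X Y Z p] koszul_metric[of X W Z p] assms
  by (simp add: koszul_add VF_add gf_add VF_deriv_add gf_smooth)

text \<open>The extra term, with its factor 2, comes from differentiating \<open>f * gf Y Z\<close>
  in \<open>koszul_metric\<close>; it becomes the Leibniz term of the connection.\<close>

lemma koszul_fscale_middle:
  assumes "X \<in> VF" "Y \<in> VF" "Z \<in> VF" "smooth_fun f"
  shows "koszul X (f \<odot> Y) Z p = 2 * X p f * gf Y Z p + f p * koszul X Y Z p"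
proof -
  have "f p * (koszul X Y Z p + koszul X Z Y p) = f p * (2 * X p (gf Y Z))"
    using koszul_metric[of X Y Z p] assms by simp
  then show ?thesis
    using koszul_metric[of X "f \<odot> Y" Z p] assms
    by (simp add: koszul_fscale VF_fscale gf_fscale VF_deriv_mult gf_smooth algebra_simps)
qed

lemma koszul_add_left:
  assumes "X \<in> VF" "Y \<in> VF" "Z \<in> VF" "W \<in> VF"
  shows "koszul (X + W) Y Z p = koszul X Y Z p + koszul W Y Z p"
  using koszul_torsion[of "X + W" Y Z p] koszul_torsion[of X Y Z p] koszul_torsion[of W Y Z p] assms
  by (simp add: koszul_add_middle VF_add bracket_add gf_add bracket_VF)

lemma koszul_fscale_left:
  assumes "X \<in> VF" "Y \<in> VF" "Z \<in> VF" "smooth_fun f"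
  shows "koszul (f \<odot> X) Y Z p = f p * koszul X Y Z p"
proof -
  have "f p * (koszul X Y Z p - koszul Y X Z p) = f p * (2 * gf (bracket X Y) Z p)"
    using koszul_torsion[of X Y Z p] assms by simp
  then show ?thesis
    using koszul_torsion[of "f \<odot> X" Y Z p] assms
    by (simp add: koszul_fscale_middle VF_fscale bracket_fscale gf_diff gf_fscale bracket_VF VF_deriv algebra_simps)
qed

lemma levi_civita_nabla: "levi_civita_connection A g nabla"
  unfolding levi_civita_connection_def affine_connection_def
proof (intro conjI ballI allI impI)
  fix X Y assume XY: "X \<in> VF" "Y \<in> VF"
  show "nabla X Y \<in> VF" by (rule nabla(1)[OF XY])
  have "nabla X Y = bracket X Y + nabla Y X"
    using XY koszul_torsion[of X Y] nabla(2)[of Y X]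
    by (intro nabla_eqI) (simp_all add: VF_add bracket_VF nabla(1) gf_add diff_eq_eq)
  then show "nabla X Y - nabla Y X = bracket X Y" by simp
  show "X p (\<lambda>q. g q (Y q) (Z q)) = g p (nabla X Y p) (Z p) + g p (Y p) (nabla X Z p)" if "Z \<in> VF" for Z p
    using koszul_metric[OF XY that, of p] nabla(2)[OF XY that, of p] nabla(2)[of X Z Y p]
      gf_sym[of "nabla X Z" Y] XY that nabla(1)[of X Z] by (simp add: gf_def fun_eq_iff)
  show "nabla (X + Y) Z = nabla X Z + nabla Y Z" if "Z \<in> VF" for Z
    using XY that nabla(2)[of X Z] nabla(2)[of Y Z]
    by (intro nabla_eqI) (simp_all add: VF_add nabla(1) gf_add koszul_add_left)
  show "nabla X (Y + Z) = nabla X Y + nabla X Z" if "Z \<in> VF" for Z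
    using XY that nabla(2)[of X Y] nabla(2)[of X Z]
    by (intro nabla_eqI) (simp_all add: VF_add nabla(1) gf_add koszul_add_middle)
  fix f assume f: "smooth_fun f"
  show "nabla (f \<odot> X) Y = f \<odot> nabla X Y"
    using XY f by (intro nabla_eqI) (simp_all add: VF_fscale nabla(1) gf_fscale koszul_fscale_left nabla(2)[symmetric])
  have "nabla X (f \<odot> Y) = (\<lambda>p. X p f) \<odot> Y + f \<odot> nabla X Y"
    using XY f by (intro nabla_eqI)
      (simp_all add: VF_fscale VF_add VF_deriv nabla(1) gf_add gf_fscale koszul_fscale_middle nabla(2)[symmetric])
  then show "nabla X (f \<odot> Y) = (\<lambda>p. X p f *\<^sub>R Y p + f p *\<^sub>R nabla X Y p)"
    by (simp add: fun_eq_iff plus_fun_apply)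
qed

end

section \<open>Curvature\<close>

locale levi_civita = metric_lie_grp A N g
  for A :: "('g::topological_space, 'e::euclidean_space) chart set" and N :: "'g monoid" (structure)
    and g :: "'g \<Rightarrow> 'g tangent \<Rightarrow> 'g tangent \<Rightarrow> real" +
  fixes D :: "'g field \<Rightarrow> 'g field \<Rightarrow> 'g field"
  assumes levi_civita: "levi_civita_connection A g D"
begin

lemma D_VF: "X \<in> VF \<Longrightarrow> Y \<in> VF \<Longrightarrow> D X Y \<in> VF"
  and D_add_left: "X \<in> VF \<Longrightarrow> Y \<in> VF \<Longrightarrow> Z \<in> VF \<Longrightarrow> D (X + Y) Z = D X Z + D Y Z"
  and D_add_right: "X \<in> VF \<Longrightarrow> Y \<in> VF \<Longrightarrow> Z \<in> VF \<Longrightarrow> D X (Y + Z) = D X Y + D X Z"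
  and D_fscale_left: "X \<in> VF \<Longrightarrow> Y \<in> VF \<Longrightarrow> smooth_fun f \<Longrightarrow> D (f \<odot> X) Y = f \<odot> D X Y"
  and D_torsion: "X \<in> VF \<Longrightarrow> Y \<in> VF \<Longrightarrow> bracket X Y = D X Y - D Y X"
  using levi_civita by (simp_all add: levi_civita_connection_def affine_connection_def)

lemma D_fscale_right:
  assumes "X \<in> VF" "Y \<in> VF" "smooth_fun f" shows "D X (f \<odot> Y) = (\<lambda>p. X p f) \<odot> Y + f \<odot> D X Y"
  using assms levi_civita
  by (simp add: levi_civita_connection_def affine_connection_def fun_eq_iff plus_fun_apply)

lemma D_metric:
  "X \<in> VF \<Longrightarrow> Y \<in> VF \<Longrightarrow> Z \<in> VF \<Longrightarrow> X p (gf Y Z) = gf (D X Y) Z p + gf Y (D X Z) p"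
  using levi_civita by (simp add: levi_civita_connection_def gf_def)

lemma D_uminus_left:
  assumes "X \<in> VF" "Y \<in> VF" shows "D (- X) Y = - D X Y"
proof -
  have e: "- W = (\<lambda>p. -1) \<odot> W" for W :: "'g field" by (simp add: fun_eq_iff)
  show ?thesis unfolding e[of X] e[of "D X Y"] by (rule D_fscale_left[OF assms smooth_fun_on_const])
qed

lemma D_diff_left:
  assumes "X \<in> VF" "Y \<in> VF" "Z \<in> VF" shows "D (X - Y) Z = D X Z - D Y Z"
  using D_add_left[OF assms(1) VF_uminus[OF assms(2)] assms(3)] D_uminus_left[OF assms(2,3)] by simp

text \<open>Metric compatibility and absence of torsion rewrite all six terms through
  \<open>D\<close>, and everything but two equal pairings cancels. Thus the values of any
  Levi-Civita connection are determined.\<close>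

lemma koszul_formula:
  assumes "X \<in> VF" "Y \<in> VF" "Z \<in> VF" shows "2 * gf (D X Y) Z p = koszul X Y Z p"
  using assms
  by (simp add: koszul_def D_metric D_torsion gf_diff D_VF gf_sym[of Y "D X Z"] gf_sym[of Z "D Y X"] gf_sym[of X "D Z Y"])

lemma curvature_skew:
  assumes "X \<in> VF" "Y \<in> VF" "Z \<in> VF" shows "curvature A D X Y Z = - curvature A D Y X Z"
  using D_uminus_left[OF bracket_VF[OF assms(2,1)] assms(3)] bracket_skew[of X Y] by (simp add: curvature_def)

lemma curvature_add_left:
  assumes "X \<in> VF" "X' \<in> VF" "Y \<in> VF" "Z \<in> VF"
  shows "curvature A D (X + X') Y Z = curvature A D X Y Z + curvature A D X' Y Z"
  using assms by (simp add: curvature_def D_add_left D_add_right bracket_add D_VF bracket_VF)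

text \<open>The Leibniz term from differentiating \<open>f \<odot> D X Z\<close> along
  \<open>Y\<close> cancels against the correction term of \<open>bracket_fscale\<close>.\<close>

lemma curvature_fscale_left:
  assumes "X \<in> VF" "Y \<in> VF" "Z \<in> VF" "smooth_fun f"
  shows "curvature A D (f \<odot> X) Y Z = f \<odot> curvature A D X Y Z"
proof -
  note Yf = VF_deriv[OF assms(2,4)]
  show ?thesis
    unfolding curvature_def bracket_fscale[OF assms(1,2,4)] D_fscale_left[OF assms(1,3,4)]
      D_fscale_left[OF assms(1) D_VF[OF assms(2,3)] assms(4)] D_fscale_right[OF assms(2) D_VF[OF assms(1,3)] assms(4)]
      D_diff_left[OF VF_fscale[OF assms(4) bracket_VF[OF assms(1,2)]] VF_fscale[OF Yf assms(1)] assms(3)]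
      D_fscale_left[OF bracket_VF[OF assms(1,2)] assms(3,4)] D_fscale_left[OF assms(1,3) Yf]
    by (rule ext) (simp add: plus_fun_apply algebra_simps)
qed

lemma curvature_add_right:
  assumes "X \<in> VF" "Y \<in> VF" "Z \<in> VF" "Z' \<in> VF"
  shows "curvature A D X Y (Z + Z') = curvature A D X Y Z + curvature A D X Y Z'"
  using assms by (simp add: curvature_def D_add_right D_VF bracket_VF)

lemma D_D_fscale:
  assumes "X \<in> VF" "Y \<in> VF" "Z \<in> VF" "smooth_fun f"
  shows "D X (D Y (f \<odot> Z)) =
    ((\<lambda>p. X p (\<lambda>q. Y q f)) \<odot> Z + (\<lambda>p. Y p f) \<odot> D X Z) + ((\<lambda>p. X p f) \<odot> D Y Z + f \<odot> D X (D Y Z))"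
proof -
  note Yf = VF_deriv[OF assms(2,4)]
  show ?thesis
    unfolding D_fscale_right[OF assms(2-4)]
      D_add_right[OF assms(1) VF_fscale[OF Yf assms(3)] VF_fscale[OF assms(4) D_VF[OF assms(2,3)]]]
      D_fscale_right[OF assms(1,3) Yf] D_fscale_right[OF assms(1) D_VF[OF assms(2,3)] assms(4)] ..
qed

text \<open>The mixed first-derivative terms are symmetric in \<open>X\<close> and \<open>Y\<close>.
  The second derivatives of \<open>f\<close> combine into its derivative along
  \<open>bracket X Y\<close>, which the last curvature term removes.\<close>

lemma curvature_fscale_right:
  assumes "X \<in> VF" "Y \<in> VF" "Z \<in> VF" "smooth_fun f"
  shows "curvature A D X Y (f \<odot> Z) = f \<odot> curvature A D X Y Z"
proof -
  have "X p (\<lambda>q. Y q f) = bracket X Y p f + Y p (\<lambda>q. X q f)" for p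
    using smooth_fun_near[OF assms(4)] by (simp add: lie_bracket_def)
  then show ?thesis
    unfolding curvature_def D_D_fscale[OF assms] D_D_fscale[OF assms(2,1,3,4)]
      D_fscale_right[OF bracket_VF[OF assms(1,2)] assms(3,4)]
    by (intro ext[of "_ :: 'g field"]) (simp add: plus_fun_apply algebra_simps)
qed

lemma curvature_zeroI:
  assumes "\<And>X Y Z. X \<in> \<nn> \<Longrightarrow> Y \<in> \<nn> \<Longrightarrow> Z \<in> \<nn> \<Longrightarrow> curvature A D X Y Z = 0"
    and "X \<in> VF" "Y \<in> VF" "Z \<in> VF"
  shows "curvature A D X Y Z = 0"
proof -
  have zero: "f \<odot> 0 = (0 :: 'g field)" for f by (simp add: fun_eq_iff zero_fun_apply)
  have 1: "curvature A D X Y Z = 0" if "X \<in> VF" "Y \<in> \<nn>" "Z \<in> \<nn>" for X Y Z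
    using that(1)
  proof (induction X rule: VF_induct)
    case (left_invariant X)
    then show ?case by (rule assms(1)[OF _ that(2,3)])
  next
    case (fscale f X)
    then show ?case using that lie_algebra_VF zero by (simp add: curvature_fscale_left subset_iff)
  next
    case (add X X')
    then show ?case using that lie_algebra_VF by (simp add: curvature_add_left subset_iff)
  qed
  have 2: "curvature A D X Y Z = 0" if X: "X \<in> VF" "Y \<in> VF" "Z \<in> \<nn>" for X Y Z
  proof -
    have Z: "Z \<in> VF" using that lie_algebra_VF by auto
    \<comment> \<open>Skewness moves the second slot to the first, where linearity over smooth
      functions has been shown.\<close>
    have "curvature A D Y X Z = 0"
      using X(2)
    proof (induction Y rule: VF_induct)
      case (left_invariant Y)
      then show ?case using curvature_skew[of Y X Z] 1[OF X(1) _ X(3), of Y] X Z lie_algebra_VF by auto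
    next
      case (fscale f Y)
      then show ?case using X Z zero by (simp add: curvature_fscale_left)
    next
      case (add Y Y')
      then show ?case using X Z by (simp add: curvature_add_left)
    qed
    then show ?thesis using curvature_skew[OF X(1,2) Z] by simp
  qed
  show ?thesis using assms(4)
  proof (induction Z rule: VF_induct)
    case (left_invariant Z)
    then show ?case by (rule 2[OF assms(2,3)])
  next
    case (fscale f Z)
    then show ?case using assms zero by (simp add: curvature_fscale_right)
  next
    case (add Z Z')
    then show ?case using assms by (simp add: curvature_add_right)
  qed
qed

end

section \<open>The center, its null part U, and the consequence of E = 0\<close>

context metric_lie_grp
begin

abbreviation "\<zz> \<equiv> lie_center \<nn> bracket"
abbreviation "\<UU> \<equiv> part_U \<nn> bracket inn"

lemma bracket_scaleR:
  assumes "X \<in> VF" "Z \<in> VF" shows "bracket (a *\<^sub>R X) Z = a *\<^sub>R bracket X Z"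
  using bracket_fscale[OF assms smooth_fun_on_const, of a] tangent_const[OF VF_tangent[OF assms(2)]]
  by (simp add: scaleR_eq_fscale fun_eq_iff)

lemma subspace_center: "subspace \<zz>"
proof (rule subspaceI)
  have "bracket 0 Y = 0" if "Y \<in> VF" for Y using bracket_scaleR[OF VF_zero that, of 0] by simp
  then show "0 \<in> \<zz>" using lie_algebra_VF n.n_closed by (auto simp: lie_center_def)
  show "X + Y \<in> \<zz>" if "X \<in> \<zz>" "Y \<in> \<zz>" for X Y
    using that lie_algebra_VF by (auto simp: lie_center_def bracket_add subset_iff n.n_closed)
  show "a *\<^sub>R X \<in> \<zz>" if "X \<in> \<zz>" for X a
    using that lie_algebra_VF by (auto simp: lie_center_def bracket_scaleR subset_iff n.n_closed)
qed

lemma subspace_U: "subspace \<UU>"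
proof -
  have "subspace (perp \<nn> inn \<zz>)"
    by (rule subspaceI) (auto simp: perp_def lie_center_def n.n_closed n.zero_left n.add_left n.scale_left)
  then show ?thesis unfolding part_U_def by (intro subspace_inter subspace_center)
qed

lemma U_subset: "\<UU> \<subseteq> \<zz>" "\<UU> \<subseteq> \<nn>"
  and U_perp: "u \<in> \<UU> \<Longrightarrow> s \<in> \<zz> \<Longrightarrow> inn u s = 0"
  by (auto simp: part_U_def perp_def lie_center_def)

lemma perp_center_subset_U:
  assumes V: "admissible_V \<nn> bracket inn V" and E: "part_E \<nn> bracket inn V = {0}"
    and X: "X \<in> \<nn>" "\<And>s. s \<in> \<zz> \<Longrightarrow> inn X s = 0"
  shows "X \<in> \<UU>"
proof -
  have V': "subspace V" "V \<subseteq> \<nn>" "\<And>v. v \<in> V \<Longrightarrow> (\<forall>u\<in>\<UU>. inn u v = 0) \<Longrightarrow> v = 0"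
    using V by (auto simp: admissible_V_def)
  obtain B where B: "B \<subseteq> V" "independent B" "V \<subseteq> span B" by (rule maximal_independent_subset)
  have sB: "span B = V" using B V' by (intro subset_antisym span_minimal)
  obtain G where G: "finite G" "span G = \<nn>" by (rule lie_algebra_finite_span)
  have fB: "finite B" using independent_span_bound[OF G(1) B(2)] B(1) V'(2) G(2) by auto
  have Bn: "B \<subseteq> \<nn>" using B V' by auto
  obtain d where d: "\<forall>c\<in>B. d c \<in> \<UU>" "\<forall>c\<in>B. \<forall>c'\<in>B. inn (d c) c' = (if c = c' then 1 else 0)"
    using n.dual_family[OF subspace_U U_subset(2) fB B(2) Bn] V'(3) sB by auto
  \<comment> \<open>\<open>u \<in> \<UU>\<close> pairs with \<open>V\<close> as \<open>X\<close> does, so \<open>X - u\<close> lies in \<open>\<EE> = 0\<close>.\<close>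
  define u where "u = (\<Sum>b\<in>B. inn X b *\<^sub>R d b)"
  have u: "u \<in> \<UU>" unfolding u_def using d by (intro subspace_sum[OF subspace_U] subspace_scale[OF subspace_U]) auto
  then have un: "u \<in> \<nn>" using U_subset by auto
  have dn: "d b \<in> \<nn>" if "b \<in> B" for b using d that U_subset by auto
  have ub: "inn u b = inn X b" if b: "b \<in> B" for b
  proof -
    have "inn u b = (\<Sum>c\<in>B. inn X c * inn (d c) b)"
      unfolding u_def using dn b Bn by (intro n.sum_left) auto
    also have "\<dots> = (\<Sum>c\<in>B. if c = b then inn X c else 0)" using d b by (intro sum.cong) auto
    finally show ?thesis using fB b by simp
  qed
  have "subspace {v \<in> \<nn>. inn v (X - u) = 0}"
    by (rule subspaceI) (use X un in \<open>auto simp: n.n_closed n.zero_left n.add_left n.scale_left\<close>)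
  moreover have s: "B \<subseteq> {v \<in> \<nn>. inn v (X - u) = 0}"
    using Bn ub X un by (auto simp: n.diff_right n.sym[of _ X] n.sym[of _ u] subset_iff)
  ultimately have "V \<subseteq> {v \<in> \<nn>. inn v (X - u) = 0}" using span_minimal[OF s] sB by simp
  then have "X - u \<in> perp \<nn> inn V" using X un by (auto simp: perp_def n.n_closed n.sym[of "X - u"])
  moreover have "inn (X - u) s = 0" if "s \<in> \<zz>" for s
    using that X un U_perp[OF u that] by (simp add: n.diff_left lie_center_def)
  \<comment> \<open>Both \<open>\<UU>\<close> and \<open>part_Z\<close> lie in the center, so
    orthogonality to the center settles these two conditions of \<open>part_E\<close> at
    once.\<close>
  then have "X - u \<in> perp \<nn> inn \<UU>" "X - u \<in> perp \<nn> inn (part_Z \<nn> bracket inn V)"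
    using X un U_subset(1) by (auto simp: perp_def part_Z_def n.n_closed)
  ultimately have "X - u \<in> part_E \<nn> bracket inn V" by (simp add: part_E_def)
  then show ?thesis using E u by simp
qed

end

section \<open>Vanishing of the curvature on left-invariant fields\<close>

context levi_civita
begin

text \<open>The derivative terms of Koszul's formula act on constants and vanish. What remains does
  not depend on the point, so \<open>D X Y\<close> is left-invariant and \<open>D\<close> can be
  iterated inside \<open>\<nn>\<close>.\<close>

lemma D_lie_algebra:
  assumes "X \<in> \<nn>" "Y \<in> \<nn>"
  shows "D X Y \<in> \<nn>"
    and "Z \<in> \<nn> \<Longrightarrow> 2 * inn (D X Y) Z = inn (bracket X Y) Z - inn (bracket Y Z) X + inn (bracket Z X) Y"
proof -
  have V: "W \<in> VF" if "W \<in> \<nn>" for W using that lie_algebra_VF by auto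
  have k: "2 * gf (D X Y) Z p = inn (bracket X Y) Z - inn (bracket Y Z) X + inn (bracket Z X) Y"
    if Z: "Z \<in> \<nn>" for Z p
    using koszul_formula[OF V V V, of X Y Z p] assms Z
      tangent_const[OF VF_tangent[OF V], of X p] tangent_const[OF VF_tangent[OF V], of Y p]
      tangent_const[OF VF_tangent[OF V], of Z p]
    by (simp add: koszul_def gf_const bracket_lie_algebra)
  show n: "D X Y \<in> \<nn>"
  proof (rule lie_algebra_const_coeffs)
    show "gf (D X Y) Z p = gf (D X Y) Z \<one>" if "Z \<in> \<nn>" for Z p using k[OF that, of p] k[OF that, of \<one>] by simp
  qed (use assms V D_VF in auto)
  show "Z \<in> \<nn> \<Longrightarrow> 2 * inn (D X Y) Z = inn (bracket X Y) Z - inn (bracket Y Z) X + inn (bracket Z X) Y"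
    using k[of Z] gf_const[OF n] by simp
qed

lemma curvature_zero:
  assumes V: "admissible_V \<nn> bracket inn V" and E: "part_E \<nn> bracket inn V = {0}"
    and U: "derived_algebra \<nn> bracket \<subseteq> \<UU>" and VF: "X \<in> VF" "Y \<in> VF" "Z \<in> VF"
  shows "curvature A D X Y Z = 0"
proof (rule curvature_zeroI[OF _ VF])
  have br: "bracket X Y \<in> \<UU>" if "X \<in> \<nn>" "Y \<in> \<nn>" for X Y
    using U that unfolding derived_algebra_def by (auto intro: span_base)
  have brc: "bracket s X = 0" "bracket X s = 0" if "s \<in> \<zz>" "X \<in> \<nn>" for s X
    using that bracket_skew[of X s] by (auto simp: lie_center_def)
  have DU: "D X Y \<in> \<UU>" if "X \<in> \<nn>" "Y \<in> \<nn>" for X Y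
  proof (rule perp_center_subset_U[OF V E D_lie_algebra(1)[OF that]])
    fix s assume s: "s \<in> \<zz>"
    then have "s \<in> \<nn>" by (simp add: lie_center_def)
    from D_lie_algebra(2)[OF that this] show "inn (D X Y) s = 0"
      using U_perp[OF br[OF that] s] brc[OF s] that by (simp add: n.zero_left)
  qed
  have D0: "D X u = 0" if X: "X \<in> \<nn>" and u: "u \<in> \<UU>" for X u
  proof (rule inn_nondegenerate)
    have un: "u \<in> \<nn>" "u \<in> \<zz>" using u U_subset by auto
    show "D X u \<in> \<nn>" by (rule D_lie_algebra(1)[OF X un(1)])
    fix Z assume Z: "Z \<in> \<nn>"
    have b: "bracket Z X \<in> \<zz>" "bracket Z X \<in> \<nn>" using br[OF Z X] U_subset by auto
    have "inn (bracket Z X) u = 0" using U_perp[OF u b(1)] n.sym[OF un(1) b(2)] by simp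
    then show "inn (D X u) Z = 0"
      using D_lie_algebra(2)[OF X un(1) Z] brc[OF un(2)] X Z by (simp add: n.zero_left)
  qed
  fix X Y Z assume n: "X \<in> \<nn>" "Y \<in> \<nn>" "Z \<in> \<nn>"
  have b: "bracket X Y \<in> \<UU>" "bracket X Y \<in> \<zz>" "bracket X Y \<in> \<nn>" using br[OF n(1,2)] U_subset by auto
  have "D (bracket X Y) Z - D Z (bracket X Y) = bracket (bracket X Y) Z"
    using D_torsion b(3) n(3) lie_algebra_VF by (metis subsetD)
  then have "D (bracket X Y) Z = 0" using D0[OF n(3) b(1)] brc(1)[OF b(2) n(3)] by simp
  then show "curvature A D X Y Z = 0" using D0 DU n by (simp add: curvature_def)
qed

end

theorem theorem3p15:
  fixes A :: "('g::{t2_space, second_countable_topology}, 'e::euclidean_space) chart set"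
    and N :: "'g monoid"
    and g :: "'g \<Rightarrow> 'g tangent \<Rightarrow> 'g tangent \<Rightarrow> real"
    and V :: "'g field set"
  assumes "lie_group A N"
    and "connected (UNIV :: 'g set)"
    and "two_step_nilpotent (lie_algebra A N) (lie_bracket A)"
    and "pseudo_riemannian_metric A g"
    and "left_invariant_metric A N g"
    and "admissible_V (lie_algebra A N) (lie_bracket A) (lie_inner N g) V"
    and "derived_algebra (lie_algebra A N) (lie_bracket A)
           \<subseteq> part_U (lie_algebra A N) (lie_bracket A) (lie_inner N g)"
    and "part_E (lie_algebra A N) (lie_bracket A) (lie_inner N g) V = {0}"
  shows "flat A g"
proof -
  have br: "lie_bracket A X Y \<in> lie_algebra A N" if "X \<in> lie_algebra A N" "Y \<in> lie_algebra A N" for X Y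
  proof -
    have "lie_bracket A X Y \<in> derived_algebra (lie_algebra A N) (lie_bracket A)"
      using that unfolding derived_algebra_def by (blast intro: span_base)
    then show ?thesis using assms(7) by (auto simp: part_U_def lie_center_def)
  qed
  interpret metric_lie_grp A N g
    using assms(1,4,5) br by unfold_locales (simp_all add: lie_group_def)
  \<comment> \<open>\<open>flat\<close> quantifies over all Levi-Civita connections, so
    \<open>D\<close> is arbitrary here; \<open>nabla\<close> only witnesses existence.\<close>
  have "curvature A D X Y Z = 0"
    if "levi_civita_connection A g D" "X \<in> VF" "Y \<in> VF" "Z \<in> VF" for D X Y Z
  proof -
    interpret levi_civita A N g D using that(1) by unfold_locales
    show ?thesis by (rule curvature_zero[OF assms(6,8,7) that(2-4)])
  qed
  then show ?thesis using levi_civita_nabla unfolding flat_def by blast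
qed

end
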